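(* For $k>0$, let $f(t)=f(t;k)$ be the solution of $f''(t)=k/f(t)$, $t\ge 0$, with $f(0)=1$ and $f'(0)=w$, where $w=w(k)\ge 0$ is such that $f(1)=1+k$, and let $g(t)=g(t;k)=t\sqrt{2k\ln t}$ for $t\ge 1$. Then there is a unique $k_c=1.0384\ldots$ such that (a) $k\ge k_c$ implies $f(t)\ge g(t)$ for all $t\ge 1$; (b) $0<k<k_c$ implies that there are $t_1(k),t_2(k)$ with $1<t_1(k)<t_2(k)<\infty$ such that $f(t)<g(t)$ when $t_1(k)<t<t_2(k)$, and $f(t)>g(t)$ when $1\le t<t_1(k)$ or $t>t_2(k)$.
   Context: For each $k>0$ there is a unique $w=w(k)\ge 0$ such that the solution of $f''=k/f$ on $[0,\infty)$ with $f(0)=1$, $f'(0)=w$ satisfies $f(1)=1+k$; this is the $w$ used in the statement. *)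

theory Defs
  imports Complex_Main "HOL-Library.FuncSet"
begin

(* The condition f t \<noteq> 0 is needed because k / 0 = 0 in HOL. Derivatives at 0 are one-sided. *)
definition solves_ode :: "real \<Rightarrow> real \<Rightarrow> (real \<Rightarrow> real) \<Rightarrow> bool" where
  "solves_ode k w f \<longleftrightarrow> f 0 = 1 \<and>
     (\<exists>f'. f' 0 = w \<and>
        (\<forall>t\<ge>0. f t \<noteq> 0 \<and>
           (f has_real_derivative f' t) (at t within {0..}) \<and>
           (f' has_real_derivative k / f t) (at t within {0..})))"

(* The solution is a function on [0, \<infinity>); extensionality fixes its irrelevant values
   at negative arguments, so that it is unique as a HOL function. *)
definition ode_solution :: "real \<Rightarrow> real \<Rightarrow> real \<Rightarrow> real" where
  "ode_solution k w = (THE f. f \<in> extensional {0..} \<and> solves_ode k w f)"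

definition w_of :: "real \<Rightarrow> real" where
  "w_of k = (THE w. w \<ge> 0 \<and> ode_solution k w 1 = 1 + k)"

definition f_sol :: "real \<Rightarrow> real \<Rightarrow> real" where
  "f_sol k = ode_solution k (w_of k)"

definition g_fun :: "real \<Rightarrow> real \<Rightarrow> real" where
  "g_fun k t = t * sqrt (2 * k * ln t)"

end

theory Submission
  imports Defs "HOL-Analysis.Analysis" "HOL-Real_Asymp.Real_Asymp"
begin

text \<open>
  Put \<open>D(y) = \<integral> exp (s^2) ds\<close> (from 0 to \<open>y\<close>), \<open>a = w / sqrt (2 k)\<close> and \<open>p = f' / sqrt (2 k)\<close>. Then \<open>f = exp (p^2 - a^2)\<close> and
  \<open>D(p(t)) = D(a) + sqrt (k/2) exp (a^2) t\<close>, so \<open>y = p(t)\<close> serves as a new time. In this variable,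
  with \<open>G = D(y) - D(a)\<close> and \<open>u = exp (y^2) / (2 G)\<close>, the inequality \<open>f < g\<close> reads
  \<open>phi = u^2 - ln G + a^2 + ln (k/2) / 2 < 0\<close>. The function \<open>phi\<close> decreases up to some point, increases
  from there on, and is positive near \<open>t = 1\<close> and near infinity, so everything depends on the sign of its minimum.
  The boundary condition makes \<open>a\<close> an increasing function of \<open>k\<close>, and \<open>phi\<close> is increasing in \<open>a\<close> and in \<open>k\<close>;
  hence the minimum changes sign at exactly one \<open>k\<close>, which is located between 649/625 = 1.0384 and 27/26
  by rational bounds.
\<close>

section \<open>Parametrisation of the solutions\<close>

definition expsq_int :: "real \<Rightarrow> real" where
  "expsq_int y = (LBINT s=0..y. exp (s\<^sup>2))"

lemma expsq_int_0 [simp]: "expsq_int 0 = 0"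
  by (simp add: expsq_int_def zero_ereal_def)

lemma DERIV_expsq_int: "(expsq_int has_real_derivative exp (y\<^sup>2)) (at y)"
proof -
  \<comment> \<open>This interval contains 0 and has \<open>y\<close> in its interior, so the
    derivative within it is the full derivative.\<close>
  have "((\<lambda>u. LBINT s=ereal 0..ereal u. exp (s\<^sup>2)) has_vector_derivative exp (y\<^sup>2))
          (at y within {-\<bar>y\<bar>-1..\<bar>y\<bar>+1})"
    by (rule interval_integral_FTC2) (auto intro!: continuous_intros)
  moreover have "at y within {-\<bar>y\<bar>-1..\<bar>y\<bar>+1} = at y"
    by (rule at_within_interior) auto
  ultimately show ?thesis
    by (simp add: has_real_derivative_iff_has_vector_derivative expsq_int_def[abs_def] zero_ereal_def)
qed

lemmas DERIV_expsq_int' [derivative_intros] = DERIV_expsq_int[THEN DERIV_chain2]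

lemma isCont_expsq_int: "isCont expsq_int y"
  using DERIV_expsq_int DERIV_isCont by blast

lemma continuous_on_expsq_int [continuous_intros]:
  "continuous_on S f \<Longrightarrow> continuous_on S (\<lambda>x. expsq_int (f x))"
  by (rule continuous_on_compose2[of UNIV expsq_int])
     (auto simp: isCont_expsq_int continuous_at_imp_continuous_on)

lemma expsq_int_strict_mono: "strict_mono expsq_int"
proof (rule strict_monoI)
  fix x y :: real assume "x < y"
  then show "expsq_int x < expsq_int y"
    by (rule DERIV_pos_imp_increasing) (meson DERIV_expsq_int exp_gt_zero)
qed

lemma expsq_int_less_iff [simp]: "expsq_int x < expsq_int y \<longleftrightarrow> x < y"
  by (simp add: expsq_int_strict_mono strict_mono_less)

lemma expsq_int_le_iff [simp]: "expsq_int x \<le> expsq_int y \<longleftrightarrow> x \<le> y"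
  by (simp add: expsq_int_strict_mono strict_mono_less_eq)

lemma expsq_int_eq_iff [simp]: "expsq_int x = expsq_int y \<longleftrightarrow> x = y"
  by (simp add: expsq_int_strict_mono strict_mono_eq)

text \<open>The integrand is at least 1. The resulting linear growth in both directions makes
  \<open>expsq_int\<close> surjective.\<close>

lemma expsq_int_growth:
  assumes "x \<le> y" shows "y - x \<le> expsq_int y - expsq_int x"
proof -
  have "expsq_int x - x \<le> expsq_int y - y"
    by (rule DERIV_nonneg_imp_nondecreasing[OF assms])
       (rule exI conjI derivative_eq_intros refl | simp)+
  then show ?thesis by simp
qed

lemma surj_expsq_int: "\<exists>y. expsq_int y = z"
proof -
  have "\<exists>y. -\<bar>z\<bar> \<le> y \<and> y \<le> \<bar>z\<bar> \<and> expsq_int y = z"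
    using expsq_int_growth[of 0 "\<bar>z\<bar>"] expsq_int_growth[of "-\<bar>z\<bar>" 0]
    by (intro IVT) (auto intro: isCont_expsq_int)
  then show ?thesis by blast
qed

definition inv_expsq_int :: "real \<Rightarrow> real" where
  "inv_expsq_int = inv expsq_int"

lemma expsq_int_inv [simp]: "expsq_int (inv_expsq_int z) = z"
  unfolding inv_expsq_int_def by (metis surj_expsq_int surjI surj_f_inv_f)

lemma inv_expsq_int_expsq_int [simp]: "inv_expsq_int (expsq_int y) = y"
  using expsq_int_eq_iff expsq_int_inv by blast

lemma DERIV_inv_expsq_int:
  "(inv_expsq_int has_real_derivative exp (- (inv_expsq_int z)\<^sup>2)) (at z)"
proof -
  have "isCont inv_expsq_int (expsq_int (inv_expsq_int z))"
    by (rule isCont_inverse_function[where d=1]) (auto intro: isCont_expsq_int)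
  then have "(inv_expsq_int has_real_derivative inverse (exp ((inv_expsq_int z)\<^sup>2))) (at z)"
    by (intro DERIV_inverse_function[where a="z-1" and b="z+1"]) (auto intro: DERIV_expsq_int)
  then show ?thesis by (simp add: exp_minus)
qed

lemmas DERIV_inv_expsq_int' [derivative_intros] = DERIV_inv_expsq_int[THEN DERIV_chain2]

section \<open>Explicit solutions of the equation and their uniqueness\<close>

lemma sqrt_two_mult_half:
  assumes "k > 0" shows "sqrt (2 * k) = 2 * sqrt (k / 2)"
proof (rule real_sqrt_unique)
  show "(2 * sqrt (k / 2))\<^sup>2 = 2 * k" using assms by (simp add: power_mult_distrib)
qed (use assms in auto)

text \<open>Multiplying the equation by \<open>f'\<close> shows that
  \<open>f'^2 / (2 k) - ln f\<close> is constant, whence \<open>f = exp (p^2 - a^2)\<close>. Then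
  \<open>p' = sqrt (k/2) * exp (a^2 - p^2)\<close> separates, since \<open>exp (p^2) * p'\<close> is
  the derivative of \<open>expsq_int p\<close>.\<close>

lemma solves_ode_param:
  assumes "k > 0"
  shows "solves_ode k (a * sqrt (2*k)) (\<lambda>t. exp ((inv_expsq_int (expsq_int a + sqrt (k/2) * exp (a\<^sup>2) * t))\<^sup>2 - a\<^sup>2))"
proof -
  define p where "p t = inv_expsq_int (expsq_int a + sqrt (k/2) * exp (a\<^sup>2) * t)" for t
  have dp: "(p has_real_derivative sqrt (k/2) * exp (a\<^sup>2 - (p t)\<^sup>2)) (at t within S)" for t S
    unfolding p_def[abs_def]
    by (rule derivative_eq_intros refl | simp add: p_def exp_diff exp_minus divide_simps)+
  have p0: "p 0 = a" by (simp add: p_def)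
  have s: "sqrt (2*k) = 2 * sqrt (k/2)" using sqrt_two_mult_half assms by blast
  have kk: "sqrt (k/2) * (2 * sqrt (k/2)) = k" using assms by (simp add: mult.left_commute)
  show ?thesis
    unfolding solves_ode_def p_def[symmetric]
  proof (intro conjI exI[of _ "\<lambda>t. p t * sqrt (2*k)"] allI impI)
    fix t :: real
    have "((\<lambda>t. (p t)\<^sup>2 - a\<^sup>2) has_real_derivative 2 * p t * (sqrt (k/2) * exp (a\<^sup>2 - (p t)\<^sup>2))) (at t within {0..})"
      by (auto intro!: derivative_eq_intros dp)
    from DERIV_chain2[OF DERIV_exp this]
    show "((\<lambda>t. exp ((p t)\<^sup>2 - a\<^sup>2)) has_real_derivative p t * sqrt (2 * k)) (at t within {0..})"
      by (rule DERIV_cong) (simp add: s exp_diff)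
    show "((\<lambda>t. p t * sqrt (2 * k)) has_real_derivative k / exp ((p t)\<^sup>2 - a\<^sup>2)) (at t within {0..})"
      by (rule DERIV_cong[OF DERIV_cmult_right[OF dp]])
         (use kk in \<open>simp add: s exp_diff divide_simps\<close>)
  qed (simp_all add: p0)
qed

text \<open>Along any solution \<open>f * exp (- p^2)\<close> and
  \<open>expsq_int p - sqrt (k/2) * exp (a^2) * t\<close> have derivative zero, and their values at
  0 determine \<open>p t\<close> and \<open>f t\<close>. The sign of \<open>f\<close> is not
  presupposed; it follows from the first of them.\<close>

lemma solves_ode_unique:
  assumes "k > 0" and sol: "solves_ode k (a * sqrt (2*k)) f" and "t \<ge> 0"
    and y: "expsq_int y = expsq_int a + sqrt (k/2) * exp (a\<^sup>2) * t"
  shows "f t = exp (y\<^sup>2 - a\<^sup>2)"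
proof -
  obtain f' where f: "f 0 = 1" "f' 0 = a * sqrt (2*k)" "\<And>t. t \<ge> 0 \<Longrightarrow> f t \<noteq> 0"
    and df: "\<And>t. t \<ge> 0 \<Longrightarrow> (f has_real_derivative f' t) (at t within {0..})"
    and df': "\<And>t. t \<ge> 0 \<Longrightarrow> (f' has_real_derivative k / f t) (at t within {0..})"
    using sol unfolding solves_ode_def by blast
  define p where "p t = f' t / sqrt (2*k)" for t
  have s: "sqrt (2*k) = 2 * sqrt (k/2)" using sqrt_two_mult_half assms by blast
  have kk: "k / x / sqrt (2*k) = sqrt (k/2) / x" for x
    using assms unfolding s by (cases "x = 0") (simp_all add: divide_eq_eq eq_divide_eq mult.left_commute)
  have dp: "(p has_real_derivative sqrt (k/2) / f t) (at t within {0..})" if "t \<ge> 0" for t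
    unfolding p_def[abs_def]
    by (rule DERIV_cong[OF DERIV_cdivide[OF df'[OF that]]])
       (rule kk)
  have p0: "p 0 = a" using assms by (simp add: p_def f)
  have f'p: "f' t = 2 * p t * sqrt (k/2)" for t using assms by (simp add: p_def s)
  have "\<exists>c. \<forall>t\<in>{0..}. f t * exp (- (p t)\<^sup>2) = c"
  proof (rule has_field_derivative_zero_constant)
    fix t :: real assume t: "t \<in> {0..}"
    show "((\<lambda>t. f t * exp (- (p t)\<^sup>2)) has_real_derivative 0) (at t within {0..})"
      by (rule DERIV_cong[OF DERIV_mult[OF df DERIV_chain2[OF DERIV_exp DERIV_minus[OF DERIV_power[OF dp]]]]])
         (use t f(3)[of t] in \<open>simp_all add: f'p\<close>)
  qed simp
  then have inv1: "f t * exp (- (p t)\<^sup>2) = exp (- a\<^sup>2)" if "t \<ge> 0" for t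
    using that f(1) p0 by (metis atLeast_iff mult_1 order_refl)
  then have ft: "f t = exp ((p t)\<^sup>2 - a\<^sup>2)" if "t \<ge> 0" for t
    using that by (simp add: exp_diff exp_minus field_simps)
  have "\<exists>c. \<forall>t\<in>{0..}. expsq_int (p t) - sqrt (k/2) * exp (a\<^sup>2) * t = c"
  proof (rule has_field_derivative_zero_constant)
    fix t :: real assume t: "t \<in> {0..}"
    show "((\<lambda>t. expsq_int (p t) - sqrt (k/2) * exp (a\<^sup>2) * t) has_real_derivative 0) (at t within {0..})"
      by (rule DERIV_cong[OF DERIV_diff[OF DERIV_expsq_int'[OF dp] DERIV_cmult[OF DERIV_ident]]])
         (use t in \<open>simp_all add: ft exp_diff\<close>)
  qed simp
  then have "expsq_int (p t) - sqrt (k/2) * exp (a\<^sup>2) * t = expsq_int a" if "t \<ge> 0" for t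
    using that p0 by (metis atLeast_iff diff_zero mult_zero_right order_refl)
  then have "p t = y" using y \<open>t \<ge> 0\<close>
    by (metis add_diff_cancel_right' diff_add_cancel expsq_int_eq_iff)
  then show ?thesis using ft \<open>t \<ge> 0\<close> by simp
qed

text \<open>Derivatives within \<open>{0..}\<close> do not see negative arguments, so every solution
  can be made extensional.\<close>

lemma solves_ode_restrict:
  assumes "solves_ode k w f" shows "solves_ode k w (restrict f {0..})"
proof -
  have "(restrict f {0..} has_real_derivative D) (at t within {0..})"
    if "(f has_real_derivative D) (at t within {0..})" "t \<ge> 0" for D t
    using that by (elim has_field_derivative_transform_within[where d=1]) auto
  moreover obtain f' where "f 0 = 1" "f' 0 = w"
    "\<forall>t\<ge>0. f t \<noteq> 0 \<and> (f has_real_derivative f' t) (at t within {0..}) \<and>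
      (f' has_real_derivative k / f t) (at t within {0..})"
    using assms unfolding solves_ode_def by blast
  ultimately show ?thesis unfolding solves_ode_def by (intro conjI exI[of _ f']) auto
qed

lemma ode_solution_eq:
  assumes "k > 0" "t \<ge> 0"
    and y: "expsq_int y = expsq_int a + sqrt (k/2) * exp (a\<^sup>2) * t"
  shows "ode_solution k (a * sqrt (2*k)) t = exp (y\<^sup>2 - a\<^sup>2)"
proof -
  let ?w = "a * sqrt (2*k)"
  have "\<exists>!f. f \<in> extensional {0..} \<and> solves_ode k ?w f"
  proof (rule ex_ex1I)
    show "\<exists>f. f \<in> extensional {0..} \<and> solves_ode k ?w f"
      using solves_ode_restrict[OF solves_ode_param[OF assms(1)]] restrict_extensional by blast
  next
    fix f g assume fg: "f \<in> extensional {0..} \<and> solves_ode k ?w f"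
      "g \<in> extensional {0..} \<and> solves_ode k ?w g"
    show "f = g"
    proof (rule extensionalityI[of _ "{0..}"])
      fix t :: real assume "t \<in> {0..}"
      then show "f t = g t"
        using fg solves_ode_unique[OF assms(1), of a _ t, OF _ _ expsq_int_inv]
        by (metis atLeast_iff)
    qed (use fg in auto)
  qed
  from theI'[OF this] have "solves_ode k ?w (ode_solution k ?w)"
    unfolding ode_solution_def by simp
  then show ?thesis using solves_ode_unique assms by blast
qed

section \<open>The boundary value problem\<close>

text \<open>Since \<open>f(1) = 1 + k\<close>, the parameter \<open>p(1)\<close> must be the following.\<close>

definition endpoint :: "real \<Rightarrow> real \<Rightarrow> real" where
  "endpoint a k = sqrt (a\<^sup>2 + ln (1 + k))"

text \<open>The time equation for \<open>p\<close> at time 1 with \<open>p = endpoint a k\<close>,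
  divided by \<open>exp (a^2)\<close>. In this scaling the defect is strictly decreasing in
  \<open>a\<close>, and its \<open>k\<close>-derivative contains no exponential.\<close>

definition bvp_defect :: "real \<Rightarrow> real \<Rightarrow> real" where
  "bvp_defect a k = exp (- a\<^sup>2) * (expsq_int (endpoint a k) - expsq_int a) - sqrt (k / 2)"

section \<open>The endpoint, and monotonicity of the defect in \<open>a\<close>\<close>

lemma endpoint_sq: "k \<ge> 0 \<Longrightarrow> (endpoint a k)\<^sup>2 = a\<^sup>2 + ln (1 + k)"
  unfolding endpoint_def by (intro real_sqrt_pow2) simp

lemma endpoint_gt:
  assumes "k > 0" "a \<ge> 0" shows "endpoint a k > a"
proof -
  have "sqrt (a\<^sup>2) < endpoint a k" unfolding endpoint_def using assms by (intro real_sqrt_less_mono) simp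
  then show ?thesis using assms by simp
qed

lemma exp_endpoint_sq: "k \<ge> 0 \<Longrightarrow> exp ((endpoint a k)\<^sup>2) = exp (a\<^sup>2) * (1 + k)"
  by (simp add: endpoint_sq exp_add)

text \<open>With \<open>y = endpoint a k\<close> the expression is \<open>- exp (a^2)\<close> times
  the \<open>a\<close>-derivative of the defect. For \<open>a > 0\<close> it vanishes at
  \<open>y = a\<close> and has \<open>y\<close>-derivative \<open>a * exp (y^2) / y^2\<close>; for
  \<open>a = 0\<close> it is 1.\<close>

lemma bvp_slope_aux:
  assumes "a \<ge> 0" "y > a"
  shows "2 * a * (expsq_int y - expsq_int a) + exp (a\<^sup>2) - a * exp (y\<^sup>2) / y > 0"
proof (cases "a = 0")
  case True then show ?thesis by simp
next
  case False
  then have a: "a > 0" using assms by simp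
  define h where "h y = 2 * a * (expsq_int y - expsq_int a) + exp (a\<^sup>2) - a * exp (y\<^sup>2) / y" for y
  have "h a < h y"
  proof (rule DERIV_pos_imp_increasing_open[OF \<open>y > a\<close>])
    fix x assume x: "a < x" "x < y"
    have "(h has_real_derivative a * exp (x\<^sup>2) / x\<^sup>2) (at x)"
      unfolding h_def[abs_def] using a x
      by (auto intro!: derivative_eq_intros DERIV_expsq_int simp: field_simps power2_eq_square)
    then show "\<exists>l. (h has_real_derivative l) (at x) \<and> 0 < l"
      using a x by (intro exI[of _ "a * exp (x\<^sup>2) / x\<^sup>2"]) auto
  next
    show "continuous_on {a..y} h"
      unfolding h_def[abs_def] using a by (auto intro!: continuous_intros)
  qed
  moreover have "h a = 0" using a by (simp add: h_def)
  ultimately show ?thesis by (simp add: h_def)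
qed

lemma DERIV_bvp_defect_fst:
  assumes "k > 0" "a \<ge> 0"
  shows "((\<lambda>a. bvp_defect a k) has_real_derivative
      - exp (- a\<^sup>2) * (2 * a * (expsq_int (endpoint a k) - expsq_int a) + exp (a\<^sup>2)
         - a * exp ((endpoint a k)\<^sup>2) / endpoint a k)) (at a)"
proof -
  have pos: "a\<^sup>2 + ln (1 + k) > 0" using assms by (simp add: add_nonneg_pos)
  have "((\<lambda>a. endpoint a k) has_real_derivative inverse (endpoint a k) / 2 * (2 * a)) (at a)"
    unfolding endpoint_def
    by (rule DERIV_chain2[where f=sqrt], rule DERIV_real_sqrt[OF pos]) (auto intro!: derivative_eq_intros)
  then have dY: "((\<lambda>a. endpoint a k) has_real_derivative a / endpoint a k) (at a)"
    by (rule DERIV_cong) (simp add: field_simps)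
  have dE: "((\<lambda>a. exp (- a\<^sup>2)) has_real_derivative - 2 * a * exp (- a\<^sup>2)) (at a)"
    by (auto intro!: derivative_eq_intros)
  have dG: "((\<lambda>a. expsq_int (endpoint a k) - expsq_int a) has_real_derivative
      exp ((endpoint a k)\<^sup>2) * (a / endpoint a k) - exp (a\<^sup>2)) (at a)"
    by (rule DERIV_diff[OF DERIV_expsq_int'[OF dY] DERIV_expsq_int])
  show ?thesis unfolding bvp_defect_def
    by (rule DERIV_cong[OF DERIV_diff[OF DERIV_mult[OF dE dG] DERIV_const]])
       (simp add: algebra_simps)
qed

lemma bvp_defect_strict_antimono:
  assumes "k > 0" "0 \<le> a" "a < b"
  shows "bvp_defect b k < bvp_defect a k"
proof (rule DERIV_neg_imp_decreasing[OF \<open>a < b\<close>])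
  fix x assume "a \<le> x" "x \<le> b"
  then have x: "x \<ge> 0" using assms by simp
  have "2 * x * (expsq_int (endpoint x k) - expsq_int x) + exp (x\<^sup>2) - x * exp ((endpoint x k)\<^sup>2) / endpoint x k > 0"
    by (rule bvp_slope_aux) (use x assms endpoint_gt in auto)
  then show "\<exists>l. ((\<lambda>a. bvp_defect a k) has_real_derivative l) (at x) \<and> l < 0"
    using DERIV_bvp_defect_fst[OF assms(1) x] by (metis exp_gt_zero mult_minus_left mult_pos_pos neg_less_0_iff_less)
qed

lemma bvp_defect_less_iff:
  assumes "k > 0" "a \<ge> 0" "b \<ge> 0"
  shows "bvp_defect b k < bvp_defect a k \<longleftrightarrow> a < b"
  using bvp_defect_strict_antimono[OF assms(1)] assms by (metis linorder_less_linear order_less_asym)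

section \<open>Dependence of the defect on \<open>k\<close>\<close>

lemma DERIV_bvp_defect_snd:
  assumes "k > 0" "a \<ge> 0"
  shows "((\<lambda>k. bvp_defect a k) has_real_derivative
      1 / (2 * endpoint a k) - 1 / (2 * sqrt (2 * k))) (at k)"
proof -
  have pos: "a\<^sup>2 + ln (1 + k) > 0" using assms by (simp add: add_nonneg_pos)
  have Y: "endpoint a k > 0" using endpoint_gt assms by fastforce
  have "((\<lambda>k. endpoint a k) has_real_derivative inverse (endpoint a k) / 2 * (1 / (1 + k))) (at k)"
    unfolding endpoint_def
    by (rule DERIV_chain2[where f=sqrt], rule DERIV_real_sqrt[OF pos])
       (use assms in \<open>auto intro!: derivative_eq_intros\<close>)
  note 1 = DERIV_cmult[OF DERIV_diff[OF DERIV_expsq_int'[OF this] DERIV_const], of "exp (- a\<^sup>2)" "expsq_int a"]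
  have 2: "((\<lambda>k. sqrt (k / 2)) has_real_derivative inverse (sqrt (k/2)) / 2 * (1 / 2)) (at k)"
    by (rule DERIV_chain2[where f=sqrt], rule DERIV_real_sqrt)
       (use assms in \<open>auto intro!: derivative_eq_intros\<close>)
  have "exp (- a\<^sup>2) * (exp (a\<^sup>2) * (1 + k) * (inverse (endpoint a k) / 2 * (1 / (1 + k)))) = 1 / (2 * endpoint a k)"
    using assms Y by (simp add: exp_minus divide_simps)
  moreover have "inverse (sqrt (k/2)) / 2 * (1 / 2) = 1 / (2 * sqrt (2 * k))"
    unfolding sqrt_two_mult_half[OF assms(1)] by (simp add: divide_simps)
  ultimately show ?thesis unfolding bvp_defect_def
    by (intro DERIV_cong[OF DERIV_diff[OF 1 2]]) (use assms in \<open>simp add: exp_endpoint_sq\<close>)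
qed

text \<open>Continuity includes \<open>k = 0\<close>, where \<open>sqrt (k / 2)\<close> has no
  derivative; the monotonicity arguments start from the value 0 there.\<close>

lemma continuous_on_bvp_defect_snd: "continuous_on {0..} (\<lambda>k. bvp_defect a k)"
  unfolding bvp_defect_def endpoint_def by (auto intro!: continuous_intros)

lemma bvp_defect_0: "a \<ge> 0 \<Longrightarrow> bvp_defect a 0 = 0"
  by (simp add: bvp_defect_def endpoint_def)

text \<open>The sign of the \<open>k\<close>-derivative is decided by comparing
  \<open>endpoint a k\<close> with \<open>sqrt (2 * k)\<close>, hence by comparing their
  squares.\<close>

lemma bvp_defect_snd_increasing:
  assumes "k > 0" "a \<ge> 0" "a\<^sup>2 + ln (1 + k) < 2 * k"
  shows "\<exists>l. ((\<lambda>k. bvp_defect a k) has_real_derivative l) (at k) \<and> 0 < l"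
proof -
  have "0 < endpoint a k" using endpoint_gt[OF assms(1,2)] assms by linarith
  moreover have "endpoint a k < sqrt (2 * k)" unfolding endpoint_def using assms by (intro real_sqrt_less_mono)
  ultimately have "1 / (2 * endpoint a k) - 1 / (2 * sqrt (2 * k)) > 0" by (simp add: frac_less2)
  then show ?thesis using DERIV_bvp_defect_snd[OF assms(1,2)] by blast
qed

lemma bvp_defect_snd_decreasing:
  assumes "k > 0" "a \<ge> 0" "2 * k < a\<^sup>2 + ln (1 + k)"
  shows "\<exists>l. ((\<lambda>k. bvp_defect a k) has_real_derivative l) (at k) \<and> l < 0"
proof -
  have "sqrt (2 * k) < endpoint a k" unfolding endpoint_def using assms by (intro real_sqrt_less_mono)
  then have "1 / (2 * endpoint a k) - 1 / (2 * sqrt (2 * k)) < 0" using assms by (simp add: frac_less2)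
  then show ?thesis using DERIV_bvp_defect_snd[OF assms(1,2)] by blast
qed

lemma two_mult_minus_ln_strict_mono:
  fixes k l :: real
  assumes "0 \<le> k" "k < l"
  shows "2 * k - ln (1 + k) < 2 * l - ln (1 + l)"
proof (rule DERIV_pos_imp_increasing[OF \<open>k < l\<close>])
  fix x assume "k \<le> x" "x \<le> l"
  then have "((\<lambda>k. 2 * k - ln (1 + k)) has_real_derivative 2 - 1 / (1 + x)) (at x)"
    using assms by (auto intro!: derivative_eq_intros)
  moreover have "2 - 1 / (1 + x) > 0" using \<open>k \<le> x\<close> assms by (simp add: field_simps)
  ultimately show "\<exists>y. ((\<lambda>k. 2 * k - ln (1 + k)) has_real_derivative y) (at x) \<and> 0 < y" by blast
qed

text \<open>The \<open>k\<close>-derivative of the defect has the sign of the increasing function \<open>2 k - ln (1 + k) - a^2\<close>,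
  so on \<open>k > 0\<close> the defect, which is 0 at \<open>k = 0\<close>, can change sign only once, upwards.\<close>

lemma bvp_defect_pos_later:
  assumes "0 < k" "k < l" "a \<ge> 0" and nn: "bvp_defect a k \<ge> 0"
  shows "bvp_defect a l > 0"
proof -
  have *: "a\<^sup>2 + ln (1 + k) < 2 * k"
  proof (rule ccontr)
    assume neg: "\<not> ?thesis"
    have "bvp_defect a k < bvp_defect a 0"
    proof (rule DERIV_neg_imp_decreasing_open[OF \<open>0 < k\<close>])
      fix x assume x: "0 < x" "x < k"
      then have "2 * x < a\<^sup>2 + ln (1 + x)" using two_mult_minus_ln_strict_mono[of x k] neg by simp
      then show "\<exists>y. ((\<lambda>k. bvp_defect a k) has_real_derivative y) (at x) \<and> y < 0"
        using x assms by (intro bvp_defect_snd_decreasing)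
    qed (auto intro: continuous_on_subset[OF continuous_on_bvp_defect_snd])
    then show False using nn bvp_defect_0[OF assms(3)] by simp
  qed
  have "bvp_defect a k < bvp_defect a l"
  proof (rule DERIV_pos_imp_increasing[OF \<open>k < l\<close>])
    fix x assume x: "k \<le> x" "x \<le> l"
    have "2 * k - ln (1 + k) \<le> 2 * x - ln (1 + x)"
      using two_mult_minus_ln_strict_mono[of k x] x assms by (cases "k = x") auto
    then have "a\<^sup>2 + ln (1 + x) < 2 * x" using * by simp
    then show "\<exists>y. ((\<lambda>k. bvp_defect a k) has_real_derivative y) (at x) \<and> 0 < y"
      using x assms by (intro bvp_defect_snd_increasing) auto
  qed
  then show ?thesis using nn by simp
qed

section \<open>Existence, uniqueness and monotonicity of the shooting parameter\<close>

lemma bvp_defect_at_0: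
  assumes "k > 0" shows "bvp_defect 0 k > 0"
proof -
  have "bvp_defect 0 0 < bvp_defect 0 k"
  proof (rule DERIV_pos_imp_increasing_open[OF assms])
    fix x assume x: "0 < x" "x < k"
    \<comment> \<open>At \<open>a = 0\<close> the criterion for increase reads
      \<open>ln (1 + x) < 2 * x\<close>, so the defect rises from 0 throughout.\<close>
    have "ln (1 + x) \<le> x" using x by (intro ln_add_one_self_le_self) auto
    then show "\<exists>y. ((\<lambda>k. bvp_defect 0 k) has_real_derivative y) (at x) \<and> 0 < y"
      using x by (intro bvp_defect_snd_increasing) auto
  qed (auto intro: continuous_on_subset[OF continuous_on_bvp_defect_snd])
  then show ?thesis by (simp add: bvp_defect_0)
qed

text \<open>By the mean value theorem the first term of the defect is at most
  \<open>(endpoint a k - a) * (1 + k)\<close>, and \<open>endpoint a k - a \<le> k / a\<close>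
  because the squares differ by \<open>ln (1 + k) \<le> k\<close>. The witness is chosen to make
  \<open>k * (1 + k) / a\<close> smaller than \<open>sqrt (k / 2)\<close>.\<close>

lemma bvp_defect_neg:
  assumes "k > 0" shows "\<exists>a>0. bvp_defect a k < 0"
proof -
  define a where "a = 1 + k * (1 + k) / sqrt (k / 2)"
  have s: "sqrt (k/2) > 0" using assms by simp
  have a: "a > 0" unfolding a_def using assms by (intro add_pos_nonneg) auto
  let ?Y = "endpoint a k"
  have Y: "?Y > a" using endpoint_gt assms a by simp
  obtain z where z: "a < z" "z < ?Y" "expsq_int ?Y - expsq_int a = (?Y - a) * exp (z\<^sup>2)"
    using MVT2[OF Y, of expsq_int "\<lambda>z. exp (z\<^sup>2)"] DERIV_expsq_int by blast
  have "expsq_int ?Y - expsq_int a \<le> (?Y - a) * (exp (a\<^sup>2) * (1 + k))"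
    unfolding z(3) exp_endpoint_sq[OF less_imp_le[OF assms], symmetric]
    using z Y a by (intro mult_left_mono) (auto intro!: power_mono)
  then have "exp (- a\<^sup>2) * (expsq_int ?Y - expsq_int a) \<le> exp (- a\<^sup>2) * ((?Y - a) * (exp (a\<^sup>2) * (1 + k)))"
    by (intro mult_left_mono) auto
  also have "\<dots> = (?Y - a) * (1 + k)" by (simp add: exp_minus)
  also have "?Y - a \<le> k / a"
  proof -
    have "(?Y - a) * a \<le> (?Y - a) * (?Y + a)" using Y a by (intro mult_left_mono) auto
    also have "\<dots> = ln (1 + k)" using endpoint_sq[of k a] assms by (simp add: algebra_simps power2_eq_square)
    also have "\<dots> \<le> k" using assms by (intro ln_add_one_self_le_self) auto
    finally show ?thesis using a by (simp add: field_simps)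
  qed
  then have "(?Y - a) * (1 + k) \<le> k / a * (1 + k)" using assms by (intro mult_right_mono) auto
  also have "\<dots> < sqrt (k / 2)"
  proof -
    have "sqrt (k/2) * a = sqrt (k/2) + k * (1 + k)" unfolding a_def using s by (simp add: field_simps)
    then have "k * (1 + k) < sqrt (k/2) * a" using s by simp
    then show ?thesis using a by (simp add: field_simps)
  qed
  finally show ?thesis using a unfolding bvp_defect_def by (intro exI[of _ a]) simp
qed

lemma bvp_defect_zero_ex1:
  assumes "k > 0" shows "\<exists>!a. a \<ge> 0 \<and> bvp_defect a k = 0"
proof -
  obtain b where b: "b > 0" "bvp_defect b k < 0" using bvp_defect_neg assms by blast
  have "\<exists>a. 0 \<le> a \<and> a \<le> b \<and> bvp_defect a k = 0"
    using b bvp_defect_at_0[OF assms]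
    by (intro IVT2) (auto intro!: DERIV_isCont[OF DERIV_bvp_defect_fst[OF assms]])
  moreover have "a = b" if "a \<ge> 0" "b \<ge> 0" "bvp_defect a k = 0" "bvp_defect b k = 0" for a b
    using bvp_defect_strict_antimono[OF assms, of a b] bvp_defect_strict_antimono[OF assms, of b a] that
    by linarith
  ultimately show ?thesis by blast
qed

definition a_of :: "real \<Rightarrow> real" where
  "a_of k = (THE a. a \<ge> 0 \<and> bvp_defect a k = 0)"

lemma a_of:
  assumes "k > 0" shows "a_of k \<ge> 0" "bvp_defect (a_of k) k = 0"
  using theI'[OF bvp_defect_zero_ex1[OF assms]] unfolding a_of_def by auto

text \<open>Since the defect decreases in \<open>a\<close>, its sign at a trial value locates
  \<open>a_of k\<close> relative to that value; the rational estimates of \<open>a_of\<close> rest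
  on this.\<close>

lemma a_of_less_iff: "k > 0 \<Longrightarrow> a \<ge> 0 \<Longrightarrow> a_of k < a \<longleftrightarrow> bvp_defect a k < 0"
  using bvp_defect_less_iff[of k "a_of k" a] a_of[of k] by simp

lemma a_of_le_iff: "k > 0 \<Longrightarrow> a \<ge> 0 \<Longrightarrow> a_of k \<le> a \<longleftrightarrow> bvp_defect a k \<le> 0"
  using bvp_defect_less_iff[of k a "a_of k"] a_of[of k] by (simp add: not_less[symmetric])

text \<open>At \<open>a_of k\<close> the defect is zero for \<open>k\<close>, hence positive for
  \<open>l\<close>; as it decreases in \<open>a\<close>, its zero for \<open>l\<close> lies further
  right.\<close>

lemma a_of_strict_mono:
  assumes "0 < k" "k < l" shows "a_of k < a_of l"
  using bvp_defect_pos_later[OF assms, of "a_of k"] a_of[of k] a_of_le_iff[of l "a_of k"] assms by simp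

lemma ode_solution_1_iff:
  assumes "k > 0" "a \<ge> 0"
  shows "ode_solution k (a * sqrt (2 * k)) 1 = 1 + k \<longleftrightarrow> bvp_defect a k = 0"
proof -
  define p where "p = inv_expsq_int (expsq_int a + sqrt (k/2) * exp (a\<^sup>2) * 1)"
  have p: "expsq_int p = expsq_int a + sqrt (k/2) * exp (a\<^sup>2) * 1" by (simp add: p_def)
  have "expsq_int p \<ge> expsq_int a" unfolding p using assms by simp
  then have pa: "p \<ge> a" by simp
  have Y: "endpoint a k > a" using endpoint_gt assms by simp
  have "ode_solution k (a * sqrt (2 * k)) 1 = 1 + k \<longleftrightarrow> exp (p\<^sup>2 - a\<^sup>2) = 1 + k"
    using ode_solution_eq[OF assms(1) _ p] by simp
  also have "\<dots> \<longleftrightarrow> exp (p\<^sup>2) = exp ((endpoint a k)\<^sup>2)"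
    using assms by (simp add: exp_endpoint_sq exp_diff field_simps)
  \<comment> \<open>Both sides are nonnegative, so equal squares force equality.\<close>
  also have "\<dots> \<longleftrightarrow> p = endpoint a k" using pa Y assms(2) by (auto simp: power2_eq_iff_nonneg)
  also have "\<dots> \<longleftrightarrow> expsq_int p = expsq_int (endpoint a k)" by simp
  also have "\<dots> \<longleftrightarrow> bvp_defect a k = 0"
    unfolding p bvp_defect_def by (auto simp: exp_minus field_simps)
  finally show ?thesis .
qed

lemma w_of_eq:
  assumes "k > 0" shows "w_of k = a_of k * sqrt (2 * k)"
  unfolding w_of_def
proof (rule the_equality)
  show "a_of k * sqrt (2 * k) \<ge> 0 \<and> ode_solution k (a_of k * sqrt (2 * k)) 1 = 1 + k"
    using ode_solution_1_iff[OF assms] a_of[OF assms] assms by simp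
next
  fix w assume w: "w \<ge> 0 \<and> ode_solution k w 1 = 1 + k"
  define a where "a = w / sqrt (2 * k)"
  have wa: "w = a * sqrt (2 * k)" using assms by (simp add: a_def)
  have a: "a \<ge> 0" using w assms by (simp add: a_def)
  then have "bvp_defect a k = 0" using ode_solution_1_iff[OF assms a] w wa by simp
  then have "a = a_of k" using bvp_defect_zero_ex1[OF assms] a a_of[OF assms] by blast
  then show "w = a_of k * sqrt (2 * k)" using wa by simp
qed

lemma f_sol_eq:
  assumes "k > 0" "t \<ge> 0"
    and "expsq_int y = expsq_int (a_of k) + sqrt (k/2) * exp ((a_of k)\<^sup>2) * t"
  shows "f_sol k t = exp (y\<^sup>2 - (a_of k)\<^sup>2)"
  unfolding f_sol_def w_of_eq[OF assms(1)] using ode_solution_eq[OF assms] .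

section \<open>Comparing the solution with g\<close>

text \<open>At \<open>y = p(t)\<close> this is \<open>(f / (t * sqrt (2 k)))^2 - ln t\<close>, with
  \<open>t\<close> eliminated by
  \<open>expsq_int y - expsq_int a = sqrt (k/2) * exp (a^2) * t\<close>.\<close>

definition phi :: "real \<Rightarrow> real \<Rightarrow> real \<Rightarrow> real" where
  "phi a k y = (exp (y\<^sup>2) / (2 * (expsq_int y - expsq_int a)))\<^sup>2
     - ln (expsq_int y - expsq_int a) + a\<^sup>2 + ln (k / 2) / 2"

text \<open>Up to positive factors, \<open>crit\<close> is the derivative of \<open>phi\<close>, \<open>crit2\<close> that of \<open>crit\<close>, and \<open>crit3\<close> that of \<open>crit2\<close>;
  the last one is strictly increasing, and a single sign change is inherited upwards along this chain.\<close>

definition crit3 :: "real \<Rightarrow> real \<Rightarrow> real" where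
  "crit3 a y = 8 * y * (expsq_int y - expsq_int a) - 4 * exp (y\<^sup>2)"

definition crit2 :: "real \<Rightarrow> real \<Rightarrow> real" where
  "crit2 a y = (4 * y\<^sup>2 - 2) * (expsq_int y - expsq_int a) - 2 * y * exp (y\<^sup>2)"

definition crit :: "real \<Rightarrow> real \<Rightarrow> real" where
  "crit a y = 2 * y * exp (y\<^sup>2) * (expsq_int y - expsq_int a) - exp (y\<^sup>2) ^ 2
     - 2 * (expsq_int y - expsq_int a)\<^sup>2"

section \<open>Derivatives of \<open>phi\<close> and the \<open>crit\<close> functions, and growth
  at infinity\<close>

lemma DERIV_phi:
  assumes "a < y"
  shows "(phi a k has_real_derivative
     exp (y\<^sup>2) * crit a y / (2 * (expsq_int y - expsq_int a) ^ 3)) (at y)"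
proof -
  define G where "G = expsq_int y - expsq_int a"
  have G: "G > 0" using assms by (simp add: G_def)
  have dG: "((\<lambda>y. expsq_int y - expsq_int a) has_real_derivative exp (y\<^sup>2)) (at y)"
    by (auto intro!: derivative_eq_intros DERIV_expsq_int)
  have dE: "((\<lambda>y. exp (y\<^sup>2)) has_real_derivative exp (y\<^sup>2) * (2 * y)) (at y)"
    by (auto intro!: derivative_eq_intros)
  note d1 = DERIV_power[OF DERIV_divide[OF dE DERIV_cmult[OF dG, of 2]], of 2]
  have d2: "((\<lambda>y. ln (expsq_int y - expsq_int a)) has_real_derivative inverse G * exp (y\<^sup>2)) (at y)"
    by (rule DERIV_chain2[where f=ln], unfold G_def[symmetric], rule DERIV_ln[OF G], rule dG)
  have alg: "2 * (E / (2 * G)) * ((E * (2 * y) * (2 * G) - E * (2 * E)) / ((2 * G) * (2 * G))) - inverse G * E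
       = E * (2 * y * E * G - E\<^sup>2 - 2 * G\<^sup>2) / (2 * G ^ 3)" for E :: real
    using G by (simp add: divide_simps power2_eq_square power3_eq_cube) (simp add: algebra_simps)
  show ?thesis unfolding phi_def[abs_def] crit_def
    apply (rule DERIV_cong)
     apply (rule DERIV_add[OF DERIV_add[OF DERIV_diff[OF d1 d2] DERIV_const] DERIV_const])
    using G assms apply simp
    using alg[of "exp (y\<^sup>2)"] unfolding G_def[symmetric] by (simp add: mult_ac)
qed

lemma DERIV_crit: "(crit a has_real_derivative exp (y\<^sup>2) * crit2 a y) (at y)"
  unfolding crit_def[abs_def] crit2_def
  by (rule derivative_eq_intros DERIV_expsq_int refl)+ (simp add: algebra_simps power2_eq_square)

lemma DERIV_crit2: "(crit2 a has_real_derivative 1 * crit3 a y) (at y)"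
  unfolding crit2_def[abs_def] crit3_def
  by (rule derivative_eq_intros DERIV_expsq_int refl)+ (simp add: algebra_simps power2_eq_square)

lemma DERIV_crit3: "(crit3 a has_real_derivative 8 * (expsq_int y - expsq_int a)) (at y)"
  unfolding crit3_def[abs_def]
  by (rule derivative_eq_intros DERIV_expsq_int refl)+ (simp add: algebra_simps power2_eq_square)

text \<open>Once \<open>h' \<ge> 1\<close>, the function grows at least linearly. This carries
  divergence to infinity up the chain of derivatives.\<close>

lemma filterlim_at_top_of_deriv:
  fixes h h' :: "real \<Rightarrow> real"
  assumes der: "\<And>y. (h has_real_derivative h' y) (at y)" and lim: "filterlim h' at_top at_top"
  shows "filterlim h at_top at_top"
proof -
  obtain b where b: "\<And>y. y \<ge> b \<Longrightarrow> h' y \<ge> 1"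
    using lim unfolding filterlim_at_top eventually_at_top_linorder by blast
  have "h y \<ge> h b + (y - b)" if "y \<ge> b" for y
  proof -
    have "h b - b \<le> h y - y"
    proof (rule DERIV_nonneg_imp_nondecreasing[OF that])
      fix x assume "b \<le> x"
      then show "\<exists>l. ((\<lambda>y. h y - y) has_real_derivative l) (at x) \<and> 0 \<le> l"
        using DERIV_diff[OF der DERIV_ident] b by (intro exI[of _ "h' x - 1"]) auto
    qed
    then show ?thesis by simp
  qed
  then have "\<forall>\<^sub>F y in at_top. h b + (y - b) \<le> h y"
    unfolding eventually_at_top_linorder by blast
  moreover have "filterlim (\<lambda>y. h b + (y - b)) at_top at_top" by real_asymp
  ultimately show ?thesis by (rule filterlim_at_top_mono[rotated])
qed

lemma expsq_int_at_top: "filterlim expsq_int at_top at_top"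
  by (rule filterlim_at_top_of_deriv[OF DERIV_expsq_int]) real_asymp

lemma gap_at_top: "filterlim (\<lambda>y. expsq_int y - expsq_int a) at_top at_top"
  using filterlim_tendsto_add_at_top[OF tendsto_const expsq_int_at_top, of "- expsq_int a"] by simp

lemma crit3_at_top: "filterlim (crit3 a) at_top at_top"
proof (rule filterlim_at_top_of_deriv[OF DERIV_crit3])
  show "filterlim (\<lambda>y. 8 * (expsq_int y - expsq_int a)) at_top at_top"
    by (rule filterlim_tendsto_pos_mult_at_top[OF tendsto_const _ gap_at_top]) simp
qed

lemma crit2_at_top: "filterlim (crit2 a) at_top at_top"
  using filterlim_at_top_of_deriv[OF DERIV_crit2] crit3_at_top by simp

lemma crit_at_top: "filterlim (crit a) at_top at_top"
proof (rule filterlim_at_top_of_deriv[OF DERIV_crit])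
  have "filterlim (\<lambda>y::real. exp (y\<^sup>2)) at_top at_top" by real_asymp
  then show "filterlim (\<lambda>y. exp (y\<^sup>2) * crit2 a y) at_top at_top"
    by (rule filterlim_at_top_mult_at_top[OF _ crit2_at_top])
qed

section \<open>Functions with a single upward sign change\<close>

definition crosses_once :: "real \<Rightarrow> (real \<Rightarrow> real) \<Rightarrow> real \<Rightarrow> bool" where
  "crosses_once a h b \<longleftrightarrow> a < b \<and> (\<forall>y. a < y \<and> y < b \<longrightarrow> h y < 0) \<and> h b = 0 \<and> (\<forall>y>b. h y > 0)"

text \<open>Up to \<open>b\<close> the function \<open>h\<close> falls from a value at most 0,
  afterwards it rises to infinity, so it has exactly one zero, and this lies beyond
  \<open>b\<close>. The value at \<open>a\<close> itself is left open in \<open>crosses_once\<close>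
  because \<open>crit2 0 0 = 0\<close>.\<close>

lemma crosses_once_antideriv:
  assumes cr: "crosses_once a d b" and ha: "h a \<le> 0" and lim: "filterlim h at_top at_top"
    and der: "\<And>y. (h has_real_derivative c y * d y) (at y)" and c: "\<And>y. c y > 0"
  shows "\<exists>b'. crosses_once a h b'"
proof -
  have ab: "a < b" and neg: "\<And>y. a < y \<Longrightarrow> y < b \<Longrightarrow> d y < 0" and pos: "\<And>y. y > b \<Longrightarrow> d y > 0"
    using cr by (auto simp: crosses_once_def)
  have cont: "continuous_on S h" for S
    using der by (meson DERIV_isCont continuous_at_imp_continuous_on)
  have dec: "h y < h a" if "a < y" "y \<le> b" for y
  proof (rule DERIV_neg_imp_decreasing_open[OF that(1)])
    fix x assume "a < x" "x < y"
    then show "\<exists>l. (h has_real_derivative l) (at x) \<and> l < 0"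
      using der c neg that by (meson less_le_trans mult_pos_neg)
  qed (rule cont)
  have inc: "h x < h y" if "b \<le> x" "x < y" for x y
  proof (rule DERIV_pos_imp_increasing_open[OF that(2)])
    fix z assume "x < z" "z < y"
    then show "\<exists>l. (h has_real_derivative l) (at z) \<and> 0 < l"
      using der c pos that by (meson le_less_trans mult_pos_pos)
  qed (rule cont)
  obtain B where B: "B \<ge> b" "h B \<ge> 0"
    using lim unfolding filterlim_at_top eventually_at_top_linorder by (meson linorder_le_cases order_refl)
  obtain b' where b': "b \<le> b'" "b' \<le> B" "h b' = 0"
    using IVT[of h b 0 B] B dec[OF ab] ha der by (force intro: DERIV_isCont)
  have "b < b'" using b' dec[OF ab] ha by (cases "b = b'") auto
  moreover have "h y < 0" if "a < y" "y < b'" for y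
  proof (cases "y \<le> b")
    case True then show ?thesis using dec that ha by fastforce
  next
    case False then show ?thesis using inc[of y b'] that b' by simp
  qed
  moreover have "h y > 0" if "y > b'" for y using inc[of b' y] that b' by simp
  ultimately show ?thesis unfolding crosses_once_def using b' ab by (intro exI[of _ b']) auto
qed

lemma crit3_strict_mono:
  assumes "a \<le> x" "x < y" shows "crit3 a x < crit3 a y"
proof (rule DERIV_pos_imp_increasing_open[OF assms(2)])
  fix z assume "x < z" "z < y"
  then show "\<exists>l. (crit3 a has_real_derivative l) (at z) \<and> 0 < l"
    using assms DERIV_crit3[of a z] by (intro exI[of _ "8 * (expsq_int z - expsq_int a)"]) auto
qed (meson DERIV_crit3 DERIV_isCont continuous_at_imp_continuous_on)

lemma crit3_crosses: "\<exists>b. crosses_once a (crit3 a) b"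
proof -
  have neg: "crit3 a a < 0" by (simp add: crit3_def)
  obtain B where B: "B \<ge> a" "crit3 a B \<ge> 0"
    using crit3_at_top[of a] unfolding filterlim_at_top eventually_at_top_linorder
    by (meson linorder_le_cases order_refl)
  obtain b where b: "a \<le> b" "b \<le> B" "crit3 a b = 0"
    using IVT[of "crit3 a" a 0 B] B neg DERIV_crit3 by (force intro: DERIV_isCont)
  have "a < b" using b neg by (cases "a = b") auto
  then show ?thesis unfolding crosses_once_def
    using b crit3_strict_mono[of a _ b] crit3_strict_mono[of a b] by (intro exI[of _ b]) auto
qed

text \<open>The sign change climbs from \<open>crit3\<close> through \<open>crit2\<close> to
  \<open>crit\<close>. The condition \<open>a \<ge> 0\<close> makes the starting value
  \<open>crit2 a a = - 2 * a * exp (a^2)\<close> nonpositive.\<close>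

lemma crit_crosses:
  assumes "a \<ge> 0" shows "\<exists>b. crosses_once a (crit a) b"
proof -
  obtain b3 where b3: "crosses_once a (crit3 a) b3" using crit3_crosses by blast
  have "crit2 a a \<le> 0" using assms by (simp add: crit2_def)
  from crosses_once_antideriv[OF b3 this crit2_at_top DERIV_crit2]
  obtain b2 where b2: "crosses_once a (crit2 a) b2" by auto
  have "crit a a \<le> 0" by (simp add: crit_def)
  from crosses_once_antideriv[OF b2 this crit_at_top DERIV_crit] show ?thesis by simp
qed

section \<open>The shape of \<open>phi\<close>, and its comparison with the original
  inequality\<close>

lemma continuous_on_phi:
  assumes "S \<subseteq> {a<..}" shows "continuous_on S (phi a k)"
  using assms by (intro continuous_at_imp_continuous_on ballI DERIV_isCont[OF DERIV_phi]) auto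

lemma phi_decreasing:
  assumes "crosses_once a (crit a) b" "a < x" "x < y" "y \<le> b"
  shows "phi a k y < phi a k x"
proof (rule DERIV_neg_imp_decreasing_open[OF assms(3)])
  fix z assume z: "x < z" "z < y"
  then have "crit a z < 0" "expsq_int z - expsq_int a > 0" using assms by (auto simp: crosses_once_def)
  then have "exp (z\<^sup>2) * crit a z / (2 * (expsq_int z - expsq_int a) ^ 3) < 0"
    by (intro divide_neg_pos mult_pos_neg) auto
  then show "\<exists>l. (phi a k has_real_derivative l) (at z) \<and> l < 0"
    using DERIV_phi[of a z k] z assms by auto
next
  show "continuous_on {x..y} (phi a k)" using assms by (intro continuous_on_phi) auto
qed

lemma phi_increasing:
  assumes "crosses_once a (crit a) b" "b \<le> x" "x < y"
  shows "phi a k x < phi a k y"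
proof (rule DERIV_pos_imp_increasing_open[OF assms(3)])
  fix z assume z: "x < z" "z < y"
  then have "crit a z > 0" "expsq_int z - expsq_int a > 0" using assms by (auto simp: crosses_once_def)
  then have "exp (z\<^sup>2) * crit a z / (2 * (expsq_int z - expsq_int a) ^ 3) > 0" by simp
  then show "\<exists>l. (phi a k has_real_derivative l) (at z) \<and> 0 < l"
    using DERIV_phi[of a z k] z assms by (auto simp: crosses_once_def)
next
  show "continuous_on {x..y} (phi a k)"
    using assms by (intro continuous_on_phi) (auto simp: crosses_once_def)
qed

text \<open>For large \<open>y\<close> this says \<open>u \<ge> y - 1 / y\<close>. Three
  differentiations of the difference \<open>s\<close> of the two sides leave an elementary function
  tending to infinity, so \<open>s2\<close>, \<open>s1\<close> and \<open>s\<close> tend to infinity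
  as well.\<close>

lemma gap_upper_eventually:
  "\<forall>\<^sub>F y in at_top. (2 * y\<^sup>2 - 2) * (expsq_int y - expsq_int a) \<le> y * exp (y\<^sup>2)"
proof -
  define s2 where "s2 y = 2 * y * exp (y\<^sup>2) - 4 * (expsq_int y - expsq_int a)" for y
  define s1 where "s1 y = 3 * exp (y\<^sup>2) - 4 * y * (expsq_int y - expsq_int a)" for y
  define s where "s y = y * exp (y\<^sup>2) - (2 * y\<^sup>2 - 2) * (expsq_int y - expsq_int a)" for y
  have "filterlim (\<lambda>y::real. (4 * y\<^sup>2 - 2) * exp (y\<^sup>2)) at_top at_top" by real_asymp
  moreover have "(s2 has_real_derivative (4 * y\<^sup>2 - 2) * exp (y\<^sup>2)) (at y)" for y
    unfolding s2_def[abs_def]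
    by (rule derivative_eq_intros DERIV_expsq_int refl)+ (simp add: algebra_simps power2_eq_square)
  ultimately have "filterlim s2 at_top at_top" by (rule filterlim_at_top_of_deriv[rotated])
  moreover have "(s1 has_real_derivative s2 y) (at y)" for y
    unfolding s1_def[abs_def] s2_def
    by (rule derivative_eq_intros DERIV_expsq_int refl)+ (simp add: algebra_simps power2_eq_square)
  ultimately have "filterlim s1 at_top at_top" by (rule filterlim_at_top_of_deriv[rotated])
  moreover have "(s has_real_derivative s1 y) (at y)" for y
    unfolding s_def[abs_def] s1_def
    by (rule derivative_eq_intros DERIV_expsq_int refl)+ (simp add: algebra_simps power2_eq_square)
  ultimately have "filterlim s at_top at_top" by (rule filterlim_at_top_of_deriv[rotated])
  then have "\<forall>\<^sub>F y in at_top. s y \<ge> 0" unfolding filterlim_at_top by blast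
  then show ?thesis by eventually_elim (simp add: s_def)
qed

lemma phi_eq:
  assumes "a < y" and u: "u = exp (y\<^sup>2) / (2 * (expsq_int y - expsq_int a))"
  shows "phi a k y = u\<^sup>2 - y\<^sup>2 + ln (2 * u) + a\<^sup>2 + ln (k / 2) / 2"
proof -
  have "2 * u = exp (y\<^sup>2) / (expsq_int y - expsq_int a)"
    unfolding u by (simp only: times_divide_eq_right mult_divide_mult_cancel_left[of 2] zero_neq_numeral not_False_eq_True)
  also have "ln \<dots> = y\<^sup>2 - ln (expsq_int y - expsq_int a)" using assms by (subst ln_div) auto
  finally have "ln (2 * u) = y\<^sup>2 - ln (expsq_int y - expsq_int a)" .
  then show ?thesis by (simp add: phi_def u)
qed

lemma phi_pos_eventually: "\<forall>\<^sub>F y in at_top. phi a k y > 0"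
proof -
  define C where "C = a\<^sup>2 + ln (k / 2) / 2"
  \<comment> \<open>With \<open>u \<ge> y - 1 / y\<close> the difference \<open>u^2 - y^2\<close>
    stays above -2, while \<open>ln (2 * u)\<close> tends to infinity.\<close>
  have "\<forall>\<^sub>F y in at_top. (y - 1 / y)\<^sup>2 - y\<^sup>2 + ln (2 * (y - 1 / y)) + C > 0" by real_asymp
  with gap_upper_eventually[of a] eventually_gt_at_top[of a] eventually_gt_at_top[of 1]
  show ?thesis
  proof eventually_elim
    case (elim y)
    define G where "G = expsq_int y - expsq_int a"
    define u where "u = exp (y\<^sup>2) / (2 * G)"
    have G: "G > 0" using elim by (simp add: G_def)
    have v0: "y - 1 / y > 0" using elim by (simp add: field_simps) (metis mult_strict_mono mult_1 less_trans zero_less_one less_imp_le)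
    have v: "y - 1 / y \<le> u"
    proof -
      have "(2 * y\<^sup>2 - 2) * G \<le> y * exp (y\<^sup>2)" using elim by (simp add: G_def)
      then show ?thesis unfolding u_def using G elim by (simp add: field_simps power2_eq_square)
    qed
    have "(y - 1/y)\<^sup>2 \<le> u\<^sup>2" using v v0 by (intro power_mono) auto
    moreover have "ln (2 * (y - 1/y)) \<le> ln (2 * u)" using v v0 by (subst ln_le_cancel_iff) auto
    ultimately show ?case using elim phi_eq[of a y u k] by (simp add: u_def G_def C_def)
  qed
qed

text \<open>A larger \<open>a\<close> shrinks the gap \<open>expsq_int y - expsq_int a\<close>,
  which raises both the square and \<open>- ln\<close> of the gap; \<open>a' < y\<close> keeps the
  gaps positive.\<close>

lemma phi_mono:
  assumes "a \<le> a'" "0 \<le> a" "a' < y" "0 < k" "k \<le> k'"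
  shows "phi a k y \<le> phi a' k' y"
proof -
  have G: "0 < expsq_int y - expsq_int a'" "expsq_int y - expsq_int a' \<le> expsq_int y - expsq_int a"
    using assms by auto
  have "exp (y\<^sup>2) / (2 * (expsq_int y - expsq_int a)) \<le> exp (y\<^sup>2) / (2 * (expsq_int y - expsq_int a'))"
    using G by (intro divide_left_mono) auto
  then have "(exp (y\<^sup>2) / (2 * (expsq_int y - expsq_int a)))\<^sup>2 \<le> (exp (y\<^sup>2) / (2 * (expsq_int y - expsq_int a')))\<^sup>2"
    using G by (intro power_mono divide_nonneg_pos) auto
  moreover have "ln (expsq_int y - expsq_int a') \<le> ln (expsq_int y - expsq_int a)" using G by simp
  moreover have "a\<^sup>2 \<le> a'\<^sup>2" using assms by (intro power_mono) auto
  moreover have "ln (k / 2) \<le> ln (k' / 2)" using assms by simp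
  ultimately show ?thesis unfolding phi_def by simp
qed

text \<open>Here \<open>f = t * sqrt (2 * k) * u\<close> and
  \<open>g = t * sqrt (2 * k) * sqrt (ln t)\<close>, while \<open>phi\<close> equals
  \<open>u^2 - ln t\<close>.\<close>

lemma f_sol_vs_g_fun:
  assumes "k > 0" "t \<ge> 1"
    and y: "expsq_int y = expsq_int (a_of k) + sqrt (k/2) * exp ((a_of k)\<^sup>2) * t"
  shows "f_sol k t < g_fun k t \<longleftrightarrow> phi (a_of k) k y < 0" "f_sol k t > g_fun k t \<longleftrightarrow> phi (a_of k) k y > 0"
proof -
  define a where "a = a_of k"
  define G where "G = expsq_int y - expsq_int a"
  define u where "u = exp (y\<^sup>2) / (2 * G)"
  have s: "sqrt (k/2) > 0" using assms by simp
  have G_eq: "G = sqrt (k/2) * exp (a\<^sup>2) * t" using y by (simp add: G_def a_def)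
  have G: "G > 0" unfolding G_eq using assms by simp
  have u: "u > 0" using G by (simp add: u_def)
  have "f_sol k t = exp (y\<^sup>2 - a\<^sup>2)" using f_sol_eq[OF assms(1) _ y] assms(2) by (simp add: a_def)
  also have "\<dots> = t * sqrt (2 * k) * u"
    unfolding u_def G_eq sqrt_two_mult_half[OF assms(1)] using s assms by (simp add: exp_diff)
  finally have f: "f_sol k t = t * sqrt (2 * k) * sqrt (u\<^sup>2)" using u by simp
  have g: "g_fun k t = t * sqrt (2 * k) * sqrt (ln t)"
    by (simp add: g_fun_def real_sqrt_mult)
  have "ln G = ln (k/2) / 2 + a\<^sup>2 + ln t"
    unfolding G_eq using assms s by (simp add: ln_mult ln_sqrt)
  then have ph: "phi a k y = u\<^sup>2 - ln t" by (simp add: phi_def u_def G_def)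
  have c: "t * sqrt (2 * k) > 0" using assms by simp
  show "f_sol k t < g_fun k t \<longleftrightarrow> phi (a_of k) k y < 0" "f_sol k t > g_fun k t \<longleftrightarrow> phi (a_of k) k y > 0"
    unfolding f g a_def[symmetric] ph mult_less_cancel_left_pos[OF c]
    by (simp_all del: real_sqrt_abs)
qed

section \<open>Rational bounds for exp and the antiderivative\<close>

text \<open>Horner scheme for a series with coefficients \<open>c i / fact i\<close>:
  \<open>n\<close> counts the remaining terms, \<open>m\<close> is the current index. Unfolding for
  a numeral \<open>n\<close> leaves one short rational operation per term.\<close>

fun horner_fact :: "(nat \<Rightarrow> real) \<Rightarrow> real \<Rightarrow> nat \<Rightarrow> nat \<Rightarrow> real" where
  "horner_fact c z 0 m = 0"
| "horner_fact c z (Suc n) m = c m + z / (1 + real m) * horner_fact c z n (Suc m)"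

lemma horner_fact_numeral [simp]:
  "horner_fact c z (numeral n) m = c m + z / (1 + real m) * horner_fact c z (pred_numeral n) (Suc m)"
  by (simp add: numeral_eq_Suc)

lemma horner_fact_eq_sum:
  "horner_fact c z n m = (\<Sum>i<n. c (m + i) * z ^ i * fact m / fact (m + i))"
proof (induction n arbitrary: m)
  case (Suc n)
  have "(\<Sum>i<n. c (m + Suc i) * z ^ Suc i * fact m / fact (m + Suc i))
      = (\<Sum>i<n. z / (1 + real m) * (c (Suc m + i) * z ^ i * fact (Suc m) / fact (Suc m + i)))"
    by (intro sum.cong refl) (simp add: divide_simps)
  then show ?case by (simp add: Suc sum.lessThan_Suc_shift sum_distrib_left del: sum.lessThan_Suc)
qed simp

text \<open>The Lagrange remainder lies between 0 and \<open>exp x * x ^ n / fact n\<close>; moving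
  the latter to the left bounds \<open>exp x\<close> above by the partial sum alone.\<close>

lemma exp_partial_sum_bounds:
  fixes x :: real assumes "x \<ge> 0"
  shows "(\<Sum>i<n. x ^ i / fact i) \<le> exp x"
    and "exp x * (1 - x ^ n / fact n) \<le> (\<Sum>i<n. x ^ i / fact i)"
proof -
  obtain t where t: "\<bar>t\<bar> \<le> \<bar>x\<bar>" "exp x = (\<Sum>i<n. x ^ i / fact i) + exp t / fact n * x ^ n"
    using Maclaurin_exp_le by blast
  show "(\<Sum>i<n. x ^ i / fact i) \<le> exp x" unfolding t(2) using assms by simp
  have "exp t / fact n * x ^ n \<le> exp x / fact n * x ^ n"
    using t(1) assms by (intro mult_right_mono divide_right_mono) auto
  moreover have "exp x * (1 - x ^ n / fact n) = exp x - exp x / fact n * x ^ n"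
    by (simp add: right_diff_distrib)
  ultimately show "exp x * (1 - x ^ n / fact n) \<le> (\<Sum>i<n. x ^ i / fact i)"
    using t(2) by linarith
qed

lemma DERIV_expsq_poly:
  "((\<lambda>y. \<Sum>i<n. y ^ (2 * i + 1) / ((2 * real i + 1) * fact i)) has_real_derivative
     (\<Sum>i<n. (y\<^sup>2) ^ i / fact i)) (at y)"
proof (rule DERIV_sum)
  fix i
  have "2 * real i + 1 \<noteq> 0" by linarith
  then show "((\<lambda>y. y ^ (2 * i + 1) / ((2 * real i + 1) * fact i)) has_real_derivative
      (y\<^sup>2) ^ i / fact i) (at y)"
    by (intro DERIV_cong[OF DERIV_cdivide[OF DERIV_pow]]) (simp add: power_mult add.commute)
qed

text \<open>Integrated form of the bounds for \<open>exp (s^2)\<close>. The factor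
  \<open>1 - (x^2) ^ n / fact n\<close> is smallest at the right end \<open>y\<close>, so its value
  \<open>q\<close> there serves on all of \<open>[0, y]\<close>.\<close>

lemma expsq_int_poly_bounds:
  assumes "y \<ge> 0"
  shows "(\<Sum>i<n. y ^ (2 * i + 1) / ((2 * real i + 1) * fact i)) \<le> expsq_int y" (is "?P y \<le> _")
    and "expsq_int y * (1 - (y\<^sup>2) ^ n / fact n) \<le> (\<Sum>i<n. y ^ (2 * i + 1) / ((2 * real i + 1) * fact i))"
proof -
  let ?S = "\<lambda>y. \<Sum>i<n. (y\<^sup>2) ^ i / fact i"
  define q where "q = 1 - (y\<^sup>2) ^ n / fact n"
  have "expsq_int 0 - ?P 0 \<le> expsq_int y - ?P y"
  proof (rule DERIV_nonneg_imp_nondecreasing[OF assms])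
    fix x :: real
    show "\<exists>l. ((\<lambda>y. expsq_int y - ?P y) has_real_derivative l) (at x) \<and> 0 \<le> l"
      using DERIV_diff[OF DERIV_expsq_int DERIV_expsq_poly] exp_partial_sum_bounds(1)[of "x\<^sup>2" n]
      by (intro exI[of _ "exp (x\<^sup>2) - ?S x"]) auto
  qed
  then show "?P y \<le> expsq_int y" by simp
  have "?P 0 - expsq_int 0 * q \<le> ?P y - expsq_int y * q"
  proof (rule DERIV_nonneg_imp_nondecreasing[OF assms])
    fix x assume x: "0 \<le> x" "x \<le> y"
    have "(x\<^sup>2) ^ n / fact n \<le> (y\<^sup>2) ^ n / fact n"
      using x by (intro divide_right_mono power_mono) auto
    then have "exp (x\<^sup>2) * q \<le> exp (x\<^sup>2) * (1 - (x\<^sup>2) ^ n / fact n)"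
      unfolding q_def by (intro mult_left_mono) auto
    also have "\<dots> \<le> ?S x" by (rule exp_partial_sum_bounds) simp
    finally show "\<exists>l. ((\<lambda>y. ?P y - expsq_int y * q) has_real_derivative l) (at x) \<and> 0 \<le> l"
      using DERIV_diff[OF DERIV_expsq_poly DERIV_cmult_right[OF DERIV_expsq_int]]
      by (intro exI[of _ "?S x - exp (x\<^sup>2) * q"]) auto
  qed
  then show "expsq_int y * (1 - (y\<^sup>2) ^ n / fact n) \<le> ?P y" by (simp add: q_def)
qed

lemma expsq_poly_eq_horner:
  "(\<Sum>i<n. y ^ (2 * i + 1) / ((2 * real i + 1) * fact i))
     = y * horner_fact (\<lambda>i. 1 / (2 * real i + 1)) (y\<^sup>2) n 0"
  unfolding horner_fact_eq_sum sum_distrib_left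
  by (intro sum.cong refl) (simp add: power_mult)

lemma exp_geI:
  assumes "0 \<le> x" "v \<le> horner_fact (\<lambda>_. 1) x n 0" shows "v \<le> exp x"
  using assms exp_partial_sum_bounds(1)[of x n] by (simp add: horner_fact_eq_sum)

text \<open>The condition \<open>x ^ n < fact n\<close> makes the factor
  \<open>1 - x ^ n / fact n\<close> positive, so that it cancels.\<close>

lemma exp_leI:
  fixes x :: real
  assumes "0 \<le> x" "x ^ n < fact n" "horner_fact (\<lambda>_. 1) x n 0 \<le> v * (1 - x ^ n / fact n)"
  shows "exp x \<le> v"
proof -
  have "1 - x ^ n / fact n > 0" using assms by simp
  moreover have "horner_fact (\<lambda>_. 1) x n 0 = (\<Sum>i<n. x ^ i / fact i)"
    by (simp add: horner_fact_eq_sum)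
  then have "exp x * (1 - x ^ n / fact n) \<le> v * (1 - x ^ n / fact n)"
    using assms(3) exp_partial_sum_bounds(2)[OF assms(1), of n] by linarith
  ultimately show ?thesis using mult_le_cancel_right_pos by blast
qed

lemma expsq_int_geI:
  assumes "0 \<le> y" "v \<le> y * horner_fact (\<lambda>i. 1 / (2 * real i + 1)) (y\<^sup>2) n 0"
  shows "v \<le> expsq_int y"
  using assms expsq_int_poly_bounds(1)[of y n] unfolding expsq_poly_eq_horner by simp

lemma expsq_int_leI:
  assumes "0 \<le> y" "(y\<^sup>2) ^ n < fact n"
    and "y * horner_fact (\<lambda>i. 1 / (2 * real i + 1)) (y\<^sup>2) n 0 \<le> v * (1 - (y\<^sup>2) ^ n / fact n)"
  shows "expsq_int y \<le> v"
proof -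
  have "1 - (y\<^sup>2) ^ n / fact n > 0" using assms by simp
  moreover have "expsq_int y * (1 - (y\<^sup>2) ^ n / fact n) \<le> v * (1 - (y\<^sup>2) ^ n / fact n)"
    using assms(1,3) expsq_int_poly_bounds(2)[of y n] unfolding expsq_poly_eq_horner by simp
  ultimately show ?thesis using mult_le_cancel_right_pos by blast
qed

section \<open>Reduction of sign claims to rational inequalities\<close>

lemma endpoint_leI:
  assumes "0 \<le> Y" "0 < k" "1 + k \<le> exp (Y\<^sup>2 - a\<^sup>2)" shows "endpoint a k \<le> Y"
proof -
  have "ln (1 + k) \<le> ln (exp (Y\<^sup>2 - a\<^sup>2))" using assms by (subst ln_le_cancel_iff) auto
  then show ?thesis unfolding endpoint_def using assms by (intro real_le_lsqrt) auto
qed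

lemma endpoint_geI:
  assumes "0 \<le> Y" "0 < k" "exp (Y\<^sup>2 - a\<^sup>2) \<le> 1 + k" shows "Y \<le> endpoint a k"
  unfolding endpoint_def using assms ln_ge_iff[of "1 + k" "Y\<^sup>2 - a\<^sup>2"]
  by (intro real_le_rsqrt) auto

text \<open>The claim is \<open>expsq_int (endpoint a k) - expsq_int a \<le> exp (a^2) * sqrt (k /
  2)\<close>; \<open>d\<close>, \<open>e\<close> and \<open>s\<close> are separate rational bounds
  for the left side and the two factors.\<close>

lemma bvp_defect_nonposI:
  assumes "expsq_int (endpoint a k) - expsq_int a \<le> d" "d \<le> e * s" "e \<le> exp (a\<^sup>2)" "0 \<le> e" "s \<le> sqrt (k / 2)" "0 \<le> s"
  shows "bvp_defect a k \<le> 0"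
proof -
  have "e * s \<le> exp (a\<^sup>2) * sqrt (k / 2)" using assms by (intro mult_mono) auto
  then have "expsq_int (endpoint a k) - expsq_int a \<le> exp (a\<^sup>2) * sqrt (k / 2)" using assms by linarith
  then show ?thesis by (simp add: bvp_defect_def exp_minus field_simps)
qed

lemma bvp_defect_nonnegI:
  assumes "d \<le> expsq_int (endpoint a k) - expsq_int a" "e * s \<le> d" "exp (a\<^sup>2) \<le> e" "sqrt (k / 2) \<le> s" "0 \<le> k"
  shows "0 \<le> bvp_defect a k"
proof -
  have "exp (a\<^sup>2) * sqrt (k / 2) \<le> e * s" using assms order_trans[OF exp_ge_zero assms(3)] by (intro mult_mono) auto
  then have "exp (a\<^sup>2) * sqrt (k / 2) \<le> expsq_int (endpoint a k) - expsq_int a" using assms by linarith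
  then show ?thesis by (simp add: bvp_defect_def exp_minus field_simps)
qed

text \<open>Negativity amounts to \<open>exp (u^2 + a^2) * sqrt (k / 2)\<close> being less than the
  gap. A lower bound \<open>G\<close> of the gap suffices, since the square and \<open>- ln\<close>
  both decrease in the gap.\<close>

lemma phi_negI:
  assumes "a < y" "0 < k" "exp (y\<^sup>2) \<le> 2 * u * G" "0 < G" "G \<le> expsq_int y - expsq_int a" "0 \<le> u"
    and "u\<^sup>2 + a\<^sup>2 \<le> v" "exp v * sqrt (k / 2) < G"
  shows "phi a k y < 0"
proof -
  define H where "H = expsq_int y - expsq_int a"
  have H: "H > 0" "G \<le> H" using assms by (auto simp: H_def)
  have "exp (y\<^sup>2) / (2 * H) \<le> exp (y\<^sup>2) / (2 * G)" using H assms by (intro divide_left_mono) auto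
  also have "\<dots> \<le> u" using assms by (simp add: field_simps)
  finally have "(exp (y\<^sup>2) / (2 * H))\<^sup>2 \<le> u\<^sup>2" using H by (intro power_mono) auto
  moreover have "ln (exp v * sqrt (k / 2)) < ln H"
    using assms(2,8) H by (subst ln_less_cancel_iff) auto
  moreover have "ln (exp v * sqrt (k / 2)) = v + ln (k / 2) / 2"
    using assms(2) by (subst ln_mult) (auto simp: ln_sqrt)
  ultimately show ?thesis using assms(7) unfolding phi_def H_def[symmetric] by linarith
qed

text \<open>At the minimum, \<open>2 u (y - u) = 1\<close>, so that \<open>phi\<close> is an increasing function of \<open>u\<close> alone there; moreover
  \<open>u\<close> is increasing where \<open>crit3\<close> is positive. So a lower bound \<open>v\<close> of \<open>u\<close> slightly before the minimum suffices.\<close>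

lemma phi_lower_bound:
  assumes "a \<ge> 0" "a < z" "crit3 a z > 0" "crit a z < 0" "0 < v" "y > a"
    and v: "2 * v * (expsq_int z - expsq_int a) \<le> exp (z\<^sup>2)"
  shows "ln (2 * v) - 1 - 1 / (4 * v\<^sup>2) + a\<^sup>2 + ln (k / 2) / 2 \<le> phi a k y"
proof -
  define u where "u y = exp (y\<^sup>2) / (2 * (expsq_int y - expsq_int a))" for y
  obtain b where b: "crosses_once a (crit a) b" using crit_crosses[OF assms(1)] by blast
  \<comment> \<open>To the right of \<open>a\<close>, \<open>crit\<close> is negative only before
    its zero \<open>b\<close>, the minimiser of \<open>phi\<close>.\<close>
  have zb: "z < b" using b assms unfolding crosses_once_def by (metis linorder_neqE_linordered_idom less_asym less_irrefl)
  have ab: "a < b" using assms zb by simp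
  have "phi a k b \<le> phi a k y"
    using phi_decreasing[OF b assms(6), of b k] phi_increasing[OF b, of b y k]
    by (cases y b rule: linorder_cases) auto
  have "v \<le> u z" using v assms by (simp add: u_def field_simps)
  also have "u z \<le> u b"
  proof (rule DERIV_nonneg_imp_nondecreasing[OF less_imp_le[OF zb]])
    fix x assume x: "z \<le> x" "x \<le> b"
    define G where "G = expsq_int x - expsq_int a"
    have G: "G > 0" using x assms by (simp add: G_def)
    have c: "crit3 a x > 0" using crit3_strict_mono[of a z x] x assms by (cases "x = z") auto
    have dE: "((\<lambda>y. exp (y\<^sup>2)) has_real_derivative exp (x\<^sup>2) * (2 * x)) (at x)"
      by (auto intro!: derivative_eq_intros)
    have dG: "((\<lambda>y. 2 * (expsq_int y - expsq_int a)) has_real_derivative 2 * exp (x\<^sup>2)) (at x)"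
      by (auto intro!: derivative_eq_intros DERIV_expsq_int)
    have "(u has_real_derivative (exp (x\<^sup>2) * (2 * x) * (2 * G) - exp (x\<^sup>2) * (2 * exp (x\<^sup>2))) / ((2 * G) * (2 * G))) (at x)"
      unfolding u_def[abs_def] G_def by (rule DERIV_divide[OF dE dG]) (use G in \<open>simp add: G_def\<close>)
    moreover have "exp (x\<^sup>2) * (2 * x) * (2 * G) - exp (x\<^sup>2) * (2 * exp (x\<^sup>2)) = exp (x\<^sup>2) * (crit3 a x / 2)"
      by (simp add: crit3_def G_def algebra_simps)
    ultimately have "(u has_real_derivative exp (x\<^sup>2) * (crit3 a x / 2) / ((2 * G) * (2 * G))) (at x)" by (simp only:)
    moreover have "exp (x\<^sup>2) * (crit3 a x / 2) / ((2 * G) * (2 * G)) \<ge> 0" using c G by simp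
    ultimately show "\<exists>l. (u has_real_derivative l) (at x) \<and> 0 \<le> l" by blast
  qed
  finally have vu: "v \<le> u b" .
  define G where "G = expsq_int b - expsq_int a"
  have G: "G > 0" using ab by (simp add: G_def)
  have ub: "u b > 0" using vu assms by simp
  have "crit a b = 0" using b by (simp add: crosses_once_def)
  moreover have "exp (b\<^sup>2) = 2 * u b * G" unfolding u_def G_def[symmetric] using G by simp
  \<comment> \<open>Substituting \<open>exp (b^2) = 2 * u b * G\<close> into
    \<open>crit a b = 0\<close> brings out the factor \<open>2 * G^2\<close> and leaves a relation
    between \<open>b\<close> and \<open>u b\<close>.\<close>
  ultimately have "(2 * b * u b - 2 * (u b)\<^sup>2 - 1) * (2 * G\<^sup>2) = 0"
    unfolding crit_def G_def[symmetric] by (simp add: algebra_simps power2_eq_square)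
  then have "2 * b * u b = 2 * (u b)\<^sup>2 + 1" using G by simp
  then have "b = u b + 1 / (2 * u b)" using ub by (simp add: field_simps power2_eq_square)
  then have "b\<^sup>2 = (u b + 1 / (2 * u b))\<^sup>2" by simp
  also have "\<dots> = (u b)\<^sup>2 + 1 + 1 / (4 * (u b)\<^sup>2)" using ub by (simp add: field_simps power2_eq_square)
  \<comment> \<open>The expansion of \<open>b^2\<close> turns \<open>(u b)^2 - b^2\<close> in
    \<open>phi_eq\<close> into \<open>- 1 - 1 / (4 * (u b)^2)\<close>.\<close>
  finally have "phi a k b = ln (2 * u b) - 1 - 1 / (4 * (u b)\<^sup>2) + a\<^sup>2 + ln (k / 2) / 2"
    using phi_eq[OF ab u_def] by simp
  moreover have "ln (2 * v) \<le> ln (2 * u b)" using vu assms by simp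
  moreover have "1 / (4 * (u b)\<^sup>2) \<le> 1 / (4 * v\<^sup>2)"
    using vu assms by (intro divide_left_mono mult_left_mono power_mono) auto
  ultimately show ?thesis using \<open>phi a k b \<le> phi a k y\<close> by linarith
qed

section \<open>Locating the critical parameter\<close>

lemma exp_4_le: "exp (4::real) \<le> 54.598150869"
  by (rule exp_leI[where n=22]) (simp_all add: fact_numeral power_divide)

text \<open>Since \<open>phi\<close> increases with \<open>a\<close>, showing it negative at
  \<open>k = 649/625\<close> calls for an upper bound on \<open>a_of\<close>. \<open>345/364\<close>
  rounds the endpoint up and \<open>9342/12965\<close> rounds \<open>sqrt (k / 2)\<close>
  down.\<close>

lemma a_of_lower: "a_of (649/625) \<le> 809/1875"
proof -
  have "exp ((345/364)\<^sup>2 - (809/1875)\<^sup>2) \<ge> 1 + (649/625 :: real)"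
    by (rule exp_geI[where n=11]) (simp_all add: power_divide)
  then have Y: "endpoint (809/1875) (649/625) \<le> 345/364" by (intro endpoint_leI) auto
  have 1: "expsq_int (345/364) \<le> 1.32779926"
    by (rule expsq_int_leI[where n=11]) (simp_all add: fact_numeral power_divide)
  have 2: "expsq_int (809/1875) \<ge> 0.459805194"
    by (rule expsq_int_geI[where n=7]) (simp_all add: power_divide)
  have 3: "1.204619179 \<le> exp ((809/1875)\<^sup>2 :: real)"
    by (rule exp_geI[where n=7]) (simp_all add: power_divide)
  have 4: "9342/12965 \<le> sqrt (649/625/2)" by (rule real_le_rsqrt) (simp add: power_divide)
  have "expsq_int (endpoint (809/1875) (649/625)) - expsq_int (809/1875) \<le> 1.32779926 - 0.459805194"
    using Y 1 2 expsq_int_le_iff[of "endpoint (809/1875) (649/625)" "345/364"] by linarith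
  then have "bvp_defect (809/1875) (649/625) \<le> 0"
    by (rule bvp_defect_nonposI[OF _ _ 3 _ 4]) simp_all
  then show ?thesis by (subst a_of_le_iff) auto
qed

lemma phi_neg_lower: "phi (a_of (649/625)) (649/625) 2 < 0"
proof -
  have 1: "expsq_int 2 \<ge> 16.45262776"
    by (rule expsq_int_geI[where n=21]) simp_all
  have 2: "expsq_int (809/1875) \<le> 0.459805195"
    by (rule expsq_int_leI[where n=7]) (simp_all add: fact_numeral power_divide)
  have 3: "exp (4749/1532 :: real) \<le> 22.195053567"
    by (rule exp_leI[where n=22]) (simp_all add: fact_numeral power_divide)
  have 4: "sqrt (649/625/2) \<le> 2906/4033" by (rule real_le_lsqrt) (simp_all add: power_divide)
  \<comment> \<open>The point 2 is close to the minimiser: for this \<open>u\<close> the product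
    \<open>2 * u * (2 - u)\<close> is about 1.0004. \<open>4749/1532\<close> lies just above
    \<open>u^2 + a^2\<close>.\<close>
  have "phi (809/1875) (649/625) 2 < 0"
  proof (rule phi_negI[where u="1.706958" and v="4749/1532" and G="16.45262776 - 0.459805195"])
    show "16.45262776 - 0.459805195 \<le> expsq_int 2 - expsq_int (809/1875)" using 1 2 by linarith
    show "exp (2\<^sup>2 :: real) \<le> 2 * 1.706958 * (16.45262776 - 0.459805195)" using exp_4_le by simp
    have "exp (4749/1532) * sqrt (649/625/2) \<le> 22.195053567 * (2906/4033 :: real)"
      using 3 4 by (intro mult_mono) auto
    also have "\<dots> < 16.45262776 - 0.459805195" by simp
    finally show "exp (4749/1532) * sqrt (649/625/2) < (16.45262776 - 0.459805195 :: real)" .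
  qed (simp_all add: power_divide)
  moreover have "phi (a_of (649/625)) (649/625) 2 \<le> phi (809/1875) (649/625) 2"
    by (rule phi_mono) (use a_of_lower a_of[of "649/625"] in auto)
  ultimately show ?thesis by linarith
qed

text \<open>At the other end \<open>phi\<close> has to be bounded below, so \<open>a_of\<close> is
  bounded below and every rounding is reversed.\<close>

lemma a_of_upper: "85/197 \<le> a_of (27/26)"
proof -
  have "exp ((1217/1284)\<^sup>2 - (85/197)\<^sup>2) \<le> 1 + (27/26 :: real)"
    by (rule exp_leI[where n=11]) (simp_all add: fact_numeral power_divide)
  then have Y: "1217/1284 \<le> endpoint (85/197) (27/26)" by (intro endpoint_geI) auto
  have 1: "expsq_int (1217/1284) \<ge> 1.327841275"
    by (rule expsq_int_geI[where n=10]) (simp_all add: power_divide)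
  have 2: "expsq_int (85/197) \<le> 0.459811718"
    by (rule expsq_int_leI[where n=7]) (simp_all add: fact_numeral power_divide)
  have 3: "exp ((85/197)\<^sup>2 :: real) \<le> 1.20462481"
    by (rule exp_leI[where n=7]) (simp_all add: fact_numeral power_divide)
  have 4: "sqrt (27/26/2) \<le> 949/1317" by (rule real_le_lsqrt) (simp_all add: power_divide)
  have "1.327841275 - 0.459811718 \<le> expsq_int (endpoint (85/197) (27/26)) - expsq_int (85/197)"
    using Y 1 2 expsq_int_le_iff[of "1217/1284" "endpoint (85/197) (27/26)"] by linarith
  then have "0 \<le> bvp_defect (85/197) (27/26)"
    by (rule bvp_defect_nonnegI[OF _ _ 3 4]) simp_all
  then show ?thesis using a_of_less_iff[of "27/26" "85/197"] by (simp add: not_less[symmetric])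
qed

lemma phi_nonneg_upper:
  assumes "y > a_of (27/26)" shows "0 \<le> phi (a_of (27/26)) (27/26) y"
proof -
  \<comment> \<open>A point just before the minimiser; \<open>v\<close> below is a lower bound for
    \<open>u\<close> at \<open>z\<close>, as \<open>phi_lower_bound\<close> requires.\<close>
  define z :: real where "z = 2681/1341"
  define G where "G = expsq_int z - expsq_int (85/197)"
  define E where "E = exp (z\<^sup>2)"
  have 1: "expsq_int z \<le> 16.41197531" unfolding z_def
    by (rule expsq_int_leI[where n=21]) (simp_all add: fact_numeral power_divide)
  \<comment> \<open>The bounds 16.1 here and 54.6 below are crude: they serve the positivity of
    \<open>G\<close> and of \<open>crit3\<close>. The sharp ones yield
    \<open>2 * v * G \<le> E\<close>.\<close>
  have 2: "expsq_int z \<ge> 16.1" unfolding z_def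
    by (rule expsq_int_geI[where n=8]) (simp_all add: power_divide)
  have 3: "E \<ge> 54.43556483" unfolding z_def E_def
    by (rule exp_geI[where n=21]) (simp_all add: power_divide)
  have 4: "E \<le> 54.6"
  proof -
    have "E \<le> exp 4" unfolding E_def z_def by (simp add: power_divide)
    also have "exp 4 \<le> (54.6::real)" by (rule order_trans[OF exp_4_le]) simp
    finally show ?thesis .
  qed
  have 5: "expsq_int (85/197) \<le> 0.459811718"
    by (rule expsq_int_leI[where n=7]) (simp_all add: fact_numeral power_divide)
  have 6: "expsq_int (85/197) \<ge> 0.459811716"
    by (rule expsq_int_geI[where n=7]) (simp_all add: power_divide)
  have 7: "900/1249 \<le> sqrt (27/26/2)" by (rule real_le_rsqrt) (simp add: power_divide)
  have 8: "exp (619/688 :: real) \<le> 2.458888346"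
    by (rule exp_leI[where n=10]) (simp_all add: fact_numeral power_divide)
  define v :: real where "v = 1841/1079"
  have G: "G > 15" "G \<le> 15.952163594" using 1 2 5 6 unfolding G_def by simp_all
  have vE: "2 * v * G \<le> E" using G 3 by (simp add: v_def)
  have c3: "crit3 (85/197) z > 0"
  proof -
    have "8 * z * G \<ge> 8 * (2681/1341) * 15" using G by (simp add: z_def)
    then show ?thesis unfolding crit3_def G_def[symmetric] E_def[symmetric] using 4 by simp
  qed
  have c1: "crit (85/197) z < 0"
  proof -
    define w where "w = E / (2 * G)"
    have w: "v \<le> w" using vE G by (simp add: w_def field_simps)
    have Ew: "E = 2 * w * G" using G by (simp add: w_def)
    \<comment> \<open>The quadratic \<open>2 * z * w - 2 * w^2 - 1\<close> decreases in
      \<open>w\<close> beyond \<open>z / 2\<close>, and \<open>v\<close> is larger than that, so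
      negativity passes from \<open>v\<close> to \<open>w\<close>.\<close>
    have "2 * z * v - 2 * v\<^sup>2 - 1 < 0" by (simp add: z_def v_def power_divide)
    moreover have "(w - v) * (z - (w + v)) \<le> 0" using w by (intro mult_nonneg_nonpos) (auto simp: z_def v_def)
    ultimately have "2 * z * w - 2 * w\<^sup>2 - 1 < 0" by (simp add: algebra_simps power2_eq_square)
    then have "(2 * z * w - 2 * w\<^sup>2 - 1) * (2 * G\<^sup>2) < 0" using G by (intro mult_neg_pos) auto
    also have "(2 * z * w - 2 * w\<^sup>2 - 1) * (2 * G\<^sup>2) = crit (85/197) z"
      unfolding crit_def G_def[symmetric] E_def[symmetric] Ew by (simp add: algebra_simps power2_eq_square)
    finally show ?thesis .
  qed
  \<comment> \<open>Nonnegativity of the bound in \<open>phi_lower_bound\<close>, in exponential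
    form; \<open>619/688\<close> rounds the exponent up.\<close>
  have "exp (1 + 1 / (4 * v\<^sup>2) - (85/197)\<^sup>2) \<le> exp (619/688)" by (simp add: v_def power_divide)
  also have "\<dots> \<le> 2 * v * (900/1249)" using 8 by (simp add: v_def)
  also have "\<dots> \<le> 2 * v * sqrt (27/26/2)" using 7 by (intro mult_left_mono) (auto simp: v_def)
  finally have "1 + 1 / (4 * v\<^sup>2) - (85/197)\<^sup>2 \<le> ln (2 * v * sqrt (27/26/2))"
    by (subst ln_ge_iff) (auto simp: v_def)
  also have "\<dots> = ln (2 * v) + ln (27/26/2) / 2"
    by (subst ln_mult) (auto simp: v_def ln_sqrt)
  finally have "0 \<le> ln (2 * v) - 1 - 1 / (4 * v\<^sup>2) + (85/197)\<^sup>2 + ln (27/26/2) / 2" by linarith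
  also have "\<dots> \<le> phi (85/197) (27/26) y"
    by (rule phi_lower_bound[where z=z])
       (use c1 c3 vE assms a_of_upper in \<open>auto simp: v_def z_def G_def E_def\<close>)
  also have "\<dots> \<le> phi (a_of (27/26)) (27/26) y"
    by (rule phi_mono) (use a_of_upper assms in auto)
  finally show ?thesis .
qed

section \<open>The critical parameter\<close>

definition dips_below :: "real \<Rightarrow> bool" where
  "dips_below k \<longleftrightarrow> (\<exists>y>a_of k. phi (a_of k) k y < 0)"

lemma expsq_int_of_time:
  assumes "k > 0" "t > 0"
  obtains y where "y > a_of k" "expsq_int y = expsq_int (a_of k) + sqrt (k/2) * exp ((a_of k)\<^sup>2) * t"
proof
  let ?y = "inv_expsq_int (expsq_int (a_of k) + sqrt (k/2) * exp ((a_of k)\<^sup>2) * t)"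
  show *: "expsq_int ?y = expsq_int (a_of k) + sqrt (k/2) * exp ((a_of k)\<^sup>2) * t" by simp
  have "expsq_int (a_of k) < expsq_int ?y" unfolding * using assms by simp
  then show "a_of k < ?y" by (simp only: expsq_int_less_iff)
qed

lemma f_sol_ge_g_fun:
  assumes "k > 0" "\<not> dips_below k" "t \<ge> 1"
  shows "f_sol k t \<ge> g_fun k t"
proof -
  obtain y where y: "y > a_of k" "expsq_int y = expsq_int (a_of k) + sqrt (k/2) * exp ((a_of k)\<^sup>2) * t"
    using expsq_int_of_time[OF assms(1), of t] assms(3) by auto
  then show ?thesis using f_sol_vs_g_fun(1)[OF assms(1,3) y(2)] assms(2) by (auto simp: dips_below_def)
qed

text \<open>The minimum of \<open>phi\<close> is negative, with positive values up to time 1 and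
  near infinity; the zeros on either side of the minimiser, converted into times, are
  \<open>t1\<close> and \<open>t2\<close>.\<close>

lemma f_sol_dips:
  assumes "k > 0" "dips_below k"
  shows "\<exists>t1 t2. 1 < t1 \<and> t1 < t2 \<and>
           (\<forall>t. t1 < t \<and> t < t2 \<longrightarrow> f_sol k t < g_fun k t) \<and>
           (\<forall>t. (1 \<le> t \<and> t < t1) \<or> t > t2 \<longrightarrow> f_sol k t > g_fun k t)"
proof -
  define a where "a = a_of k"
  define c where "c = sqrt (k/2) * exp (a\<^sup>2)"
  have c: "c > 0" using assms by (simp add: c_def)
  have a0: "a \<ge> 0" using a_of[OF assms(1)] by (simp add: a_def)
  \<comment> \<open>\<open>T\<close> is the increasing map from the parameter \<open>y\<close> back
    to time.\<close>
  define T where "T y = (expsq_int y - expsq_int a) / c" for y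
  have T_less: "T x < T y \<longleftrightarrow> x < y" for x y using c by (simp add: T_def divide_less_cancel)
  have eqT: "expsq_int y = expsq_int a + c * t \<longleftrightarrow> T y = t" for y t using c by (auto simp: T_def field_simps)
  note cmp = f_sol_vs_g_fun[OF assms(1), folded a_def, folded c_def, unfolded eqT]
  obtain b where b: "crosses_once a (crit a) b" using crit_crosses[OF a0] by blast
  obtain z where z: "z > a" "phi a k z < 0" using assms(2) by (auto simp: dips_below_def a_def)
  have "phi a k b \<le> phi a k z"
    using phi_decreasing[OF b z(1), of b k] phi_increasing[OF b, of b z k]
    by (cases z b rule: linorder_cases) auto
  with z have phb: "phi a k b < 0" by simp
  obtain y1 where y1: "y1 > a" "T y1 = 1"
    using expsq_int_of_time[OF assms(1), of 1, folded a_def, folded c_def, unfolded eqT] by auto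
  \<comment> \<open>Up to time 1 the gap is at most \<open>c\<close>, so the terms of
    \<open>phi\<close> other than the square add up to at least 0.\<close>
  have start: "phi a k y > 0" if "a < y" "y \<le> y1" for y
  proof -
    define G where "G = expsq_int y - expsq_int a"
    have G: "G > 0" using that by (simp add: G_def)
    have "T y \<le> 1" using T_less[of y1 y] that y1 by linarith
    then have "G \<le> c" using c by (simp add: T_def G_def)
    then have "ln G \<le> ln c" using G c by simp
    also have "\<dots> = ln (k/2) / 2 + a\<^sup>2" unfolding c_def using assms by (subst ln_mult) (auto simp: ln_sqrt)
    finally have "ln G \<le> ln (k/2) / 2 + a\<^sup>2" .
    moreover have "(exp (y\<^sup>2) / (2 * G))\<^sup>2 > 0" using G by simp
    ultimately show ?thesis unfolding phi_def G_def[symmetric] by linarith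
  qed
  have ab: "a < b" using b by (simp add: crosses_once_def)
  have y1b: "y1 < b" using start[of b] phb ab by linarith
  have cont: "isCont (phi a k) x" if "x > a" for x using DERIV_isCont[OF DERIV_phi] that by blast
  obtain x1 where x1: "y1 \<le> x1" "x1 \<le> b" "phi a k x1 = 0"
    using IVT2[of "phi a k" b 0 y1] start[OF y1(1)] phb y1b y1 cont by force
  obtain B where B: "B \<ge> b" "phi a k B > 0"
    using phi_pos_eventually[of a k] unfolding eventually_at_top_linorder by (meson linorder_le_cases order_refl)
  obtain x2 where x2: "b \<le> x2" "x2 \<le> B" "phi a k x2 = 0"
    using IVT[of "phi a k" b 0 B] B phb ab cont by force
  have x1b: "y1 < x1" "x1 < b" using x1 start[of y1] y1 phb by (auto simp: order.order_iff_strict)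
  have x2b: "b < x2" using x2 phb by (auto simp: order.order_iff_strict)
  show ?thesis
  proof (rule exI[of _ "T x1"], rule exI[of _ "T x2"], intro conjI allI impI)
    show "1 < T x1" using T_less[of y1 x1] y1 x1b by simp
    show "T x1 < T x2" using T_less x1b x2b by simp
  next
    fix t assume t: "T x1 < t \<and> t < T x2"
    have t1: "1 < t" using T_less[of y1 x1] y1 x1b t by simp
    obtain y where y: "y > a" "T y = t"
      using expsq_int_of_time[OF assms(1), of t, folded a_def, folded c_def, unfolded eqT] t1 by auto
    have xy: "x1 < y" "y < x2" using t y(2) T_less by auto
    have "phi a k y < 0"
    proof (cases "y \<le> b")
      case True then show ?thesis using phi_decreasing[OF b _ xy(1), of k] x1 x1b y1 by simp
    next
      case False then show ?thesis using phi_increasing[OF b _ xy(2), of k] x2 by simp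
    qed
    then show "f_sol k t < g_fun k t" using cmp(1) y t1 by simp
  next
    fix t assume t: "(1 \<le> t \<and> t < T x1) \<or> t > T x2"
    have "1 < T x2" using T_less[of y1 x2] y1 x1b x2b by simp
    then have t1: "1 \<le> t" using t by auto
    obtain y where y: "y > a" "T y = t"
      using expsq_int_of_time[OF assms(1), of t, folded a_def, folded c_def, unfolded eqT] t1 by auto
    have "y < x1 \<or> x2 < y" using t y(2) T_less by auto
    then have "phi a k y > 0"
    proof
      assume "y < x1" then show ?thesis using phi_decreasing[OF b y(1), of x1 k] x1 by simp
    next
      assume "x2 < y" then show ?thesis using phi_increasing[OF b x2(1), of y k] x2 by simp
    qed
    then show "f_sol k t > g_fun k t" using cmp(2) y t1 by simp
  qed
qed

text \<open>Both \<open>a_of\<close> and \<open>phi\<close> are increasing, so the same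
  \<open>y\<close> is a witness for the smaller parameter.\<close>

lemma dips_below_antimono:
  assumes "0 < k" "k \<le> l" "dips_below l" shows "dips_below k"
proof -
  obtain y where y: "y > a_of l" "phi (a_of l) l y < 0" using assms by (auto simp: dips_below_def)
  have a: "a_of k \<le> a_of l" using a_of_strict_mono[of k l] assms by (cases "k = l") auto
  then have "phi (a_of k) k y \<le> phi (a_of l) l y" using assms y a_of[of k] by (intro phi_mono) auto
  then show ?thesis unfolding dips_below_def using y a by (intro exI[of _ y]) auto
qed

text \<open>Continuity of \<open>a_of\<close> is avoided: first \<open>a\<close> is raised to some
  \<open>a' > a_of k\<close> with \<open>phi\<close> still negative at \<open>y\<close>. The defect
  at \<open>a'\<close> is then strictly negative for \<open>k\<close>, hence also for nearby
  \<open>l > k\<close>, which gives \<open>a_of l \<le> a'\<close>.\<close>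

lemma dips_below_right_open:
  assumes "0 < k" "dips_below k" shows "\<exists>l>k. dips_below l"
proof -
  define a where "a = a_of k"
  have a0: "a \<ge> 0" using a_of[OF assms(1)] by (simp add: a_def)
  obtain y where y: "y > a" "phi a k y < 0" using assms by (auto simp: dips_below_def a_def)
  have "isCont (\<lambda>a. phi a k y) a"
    unfolding phi_def using y by (intro continuous_intros isCont_expsq_int) auto
  then have "((\<lambda>a. phi a k y) \<longlongrightarrow> phi a k y) (at_right a)"
    using continuous_at_imp_continuous_at_within continuous_within by blast
  then have "\<forall>\<^sub>F a' in at_right a. phi a' k y < 0" using y(2) by (rule order_tendstoD(2))
  moreover have "\<forall>\<^sub>F a' in at_right a. a' < y" "\<forall>\<^sub>F a' in at_right a. a < a'"
    using y(1) eventually_at_right by (blast, simp add: eventually_at_right_less)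
  ultimately have "\<forall>\<^sub>F a' in at_right a. phi a' k y < 0 \<and> a' < y \<and> a < a'"
    by eventually_elim simp
  then obtain a' where a': "a < a'" "a' < y" "phi a' k y < 0"
    using eventually_happens'[OF trivial_limit_at_right_real] by blast
  have "bvp_defect a' k < 0" using a_of_less_iff[of k a'] a' a0 assms by (simp add: a_def)
  moreover have "isCont (\<lambda>l. bvp_defect a' l) k"
    using DERIV_isCont[OF DERIV_bvp_defect_snd] assms a' a0 by simp
  then have "((\<lambda>l. bvp_defect a' l) \<longlongrightarrow> bvp_defect a' k) (at_right k)"
    using continuous_at_imp_continuous_at_within continuous_within by blast
  ultimately have "\<forall>\<^sub>F l in at_right k. bvp_defect a' l < 0" by (metis order_tendstoD(2))
  moreover have "isCont (\<lambda>l. phi a' l y) k"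
    unfolding phi_def using a' assms by (intro continuous_intros isCont_expsq_int) auto
  then have "((\<lambda>l. phi a' l y) \<longlongrightarrow> phi a' k y) (at_right k)"
    using continuous_at_imp_continuous_at_within continuous_within by blast
  then have "\<forall>\<^sub>F l in at_right k. phi a' l y < 0" using a'(3) by (rule order_tendstoD(2))
  ultimately have "\<forall>\<^sub>F l in at_right k. bvp_defect a' l < 0 \<and> phi a' l y < 0 \<and> k < l"
    using eventually_at_right_less[of k] by eventually_elim simp
  then obtain l where l: "k < l" "bvp_defect a' l < 0" "phi a' l y < 0"
    using eventually_happens'[OF trivial_limit_at_right_real] by blast
  have al: "a_of l \<le> a'" using a_of_less_iff[of l a'] l a' a0 assms by simp
  have "phi (a_of l) l y \<le> phi a' l y" using al a' l assms a_of[of l] by (intro phi_mono) auto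
  then have "dips_below l" unfolding dips_below_def using l al a' by (intro exI[of _ y]) auto
  then show ?thesis using l by blast
qed

theorem theorem3p2:
  "\<exists>kc::real. 1.0384 \<le> kc \<and> kc < 1.0385 \<and>
     (\<forall>c::real.
        ((\<forall>k>0. k \<ge> c \<longrightarrow> (\<forall>t\<ge>1. f_sol k t \<ge> g_fun k t)) \<and>
         (\<forall>k>0. k < c \<longrightarrow>
            (\<exists>t1 t2. 1 < t1 \<and> t1 < t2 \<and>
               (\<forall>t. t1 < t \<and> t < t2 \<longrightarrow> f_sol k t < g_fun k t) \<and>
               (\<forall>t. (1 \<le> t \<and> t < t1) \<or> t > t2 \<longrightarrow> f_sol k t > g_fun k t))))
        \<longleftrightarrow> c = kc)"
proof -
  define A where "A = {k. 0 < k \<and> dips_below k}"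
  define kc where "kc = Sup A"
  have lo: "649/625 \<in> A"
    unfolding A_def dips_below_def using phi_neg_lower a_of_lower by (auto intro!: exI[of _ 2])
  have hi: "\<not> dips_below (27/26)"
    unfolding dips_below_def using phi_nonneg_upper by force
  have ub: "k \<le> 27/26" if "k \<in> A" for k
    using that hi dips_below_antimono[of "27/26" k] by (force simp: A_def)
  have bdd: "bdd_above A" using ub by (rule bdd_aboveI)
  have kc: "649/625 \<le> kc" "kc \<le> 27/26"
    unfolding kc_def using cSup_upper[OF lo bdd] cSup_least[of A "27/26"] lo ub by blast+
  have below: "dips_below k" if "0 < k" "k < kc" for k
  proof -
    have "k < Sup A" using that by (simp add: kc_def)
    then obtain l where "l \<in> A" "k < l" using less_cSupD[of A k] lo by blast
    then show ?thesis using dips_below_antimono[of k l] that by (auto simp: A_def)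
  qed
  \<comment> \<open>Openness to the right keeps the supremum itself out of \<open>A\<close>, so case
    (a) includes \<open>kc\<close>.\<close>
  have above: "\<not> dips_below k" if "k \<ge> kc" for k
  proof
    assume "dips_below k"
    moreover have "k > 0" using that kc by simp
    ultimately obtain l where "l > k" "dips_below l" using dips_below_right_open by blast
    then have "l \<in> A" using \<open>k > 0\<close> by (simp add: A_def)
    then have "l \<le> kc" unfolding kc_def using bdd by (rule cSup_upper)
    then show False using \<open>l > k\<close> that by simp
  qed
  define Pa where "Pa k \<longleftrightarrow> (\<forall>t\<ge>1. f_sol k t \<ge> g_fun k t)" for k
  define Pb where "Pb k \<longleftrightarrow> (\<exists>t1 t2. 1 < t1 \<and> t1 < t2 \<and>
               (\<forall>t. t1 < t \<and> t < t2 \<longrightarrow> f_sol k t < g_fun k t) \<and>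
               (\<forall>t. (1 \<le> t \<and> t < t1) \<or> t > t2 \<longrightarrow> f_sol k t > g_fun k t))" for k
  have Pa: "Pa k" if "k \<ge> kc" for k
    unfolding Pa_def using f_sol_ge_g_fun above that kc by simp
  have Pb: "Pb k" if "0 < k" "k < kc" for k
    unfolding Pb_def using f_sol_dips below that by blast
  \<comment> \<open>The two behaviours exclude each other; this yields uniqueness of the
    threshold.\<close>
  have excl: "\<not> (Pa k \<and> Pb k)" for k
  proof
    assume "Pa k \<and> Pb k"
    then obtain t1 t2 where t: "1 < t1" "t1 < t2" "\<And>t. t1 < t \<Longrightarrow> t < t2 \<Longrightarrow> f_sol k t < g_fun k t"
      and Pa: "\<And>t. t \<ge> 1 \<Longrightarrow> f_sol k t \<ge> g_fun k t"
      unfolding Pa_def Pb_def by blast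
    obtain t where "t1 < t" "t < t2" using dense[OF t(2)] by blast
    then show False using t(1) t(3)[of t] Pa[of t] by simp
  qed
  have "((\<forall>k>0. k \<ge> c \<longrightarrow> Pa k) \<and> (\<forall>k>0. k < c \<longrightarrow> Pb k)) \<longleftrightarrow> c = kc" for c
  proof
    assume *: "(\<forall>k>0. k \<ge> c \<longrightarrow> Pa k) \<and> (\<forall>k>0. k < c \<longrightarrow> Pb k)"
    show "c = kc"
    proof (rule ccontr)
      assume "c \<noteq> kc"
      then consider "c < kc" | "kc < c" by linarith
      then show False
      proof cases
        case 1
        \<comment> \<open>Taking \<open>max c 0\<close> keeps \<open>k\<close> positive when
          \<open>c\<close> is negative; both behaviours would hold at this \<open>k\<close>.\<close>
        define k where "k = (max c 0 + kc) / 2"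
        have "0 < k" "c \<le> k" "k < kc" using 1 kc by (auto simp: k_def max_def)
        then show ?thesis using * Pb excl by blast
      next
        case 2
        \<comment> \<open>Here both behaviours would hold at \<open>kc\<close> itself.\<close>
        have "0 < kc" using kc by simp
        then show ?thesis using * Pa[of kc] 2 excl by blast
      qed
    qed
  qed (use Pa Pb kc in auto)
  then show ?thesis
    unfolding Pa_def Pb_def using kc by (intro exI[of _ kc]) simp
qed

end
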